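(* There exist two previously unknown $2$-parameter non-affine families of complex Hadamard matrices of order $6$, namely $X_6(x,y,u,v)$ and $X_6^T(x,y,u,v)$, where $X_6(x,y,u,v)$ is the matrix $$X_6(x,y,u,v)=\begin{bmatrix} 1 & 1 & 1 & 1 & 1 & 1 \\ 1 & x^2 y & x y^2 & \frac{x y}{u v} & u x y & v x y \\ 1 & \frac{x}{y} & x^2 y & \frac{x}{u} & \frac{x}{v} & u v x \\ 1 & u v x & u x y & -1 & -u x y & -u v x \\ 1 & \frac{x}{u} & v x y & -\frac{x}{u} & -1 & -v x y \\ 1 & \frac{x}{v} & \frac{x y}{u v} & -\frac{x y}{u v} & -\frac{x}{v} & -1 \end{bmatrix}$$ and $X_6^T(x,y,u,v)$ is its transpose. The two real parameters are those of a point $\alpha\in\mathbb{D}$: for $\alpha\in\mathbb{D}$ the values of $x$ and $y$ are determined as roots of $f_\alpha$, while the values of $u$ and $v$ are determined as roots of $f_{-\alpha}$ (with the convention on the choice of roots, the region $\mathbb{D}$ and the polynomials $f_\alpha$ given in the context).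
   Context: $\mathbb{T}=\{z\in\mathbb{C}:|z|=1\}$. A complex Hadamard matrix of order $n$ is an $n\times n$ matrix $H$ with all entries in $\mathbb{T}$ and $HH^\ast=nI_n$. Two complex Hadamard matrices $H,K$ are equivalent if $H=D_1PKQD_2$ for some unitary diagonal matrices $D_1,D_2$ and permutation matrices $P,Q$. Let $\varphi:\mathbb{T}\times\mathbb{T}\to\mathbb{C}$, $\varphi[x,y]=x+y+\frac{1}{xy}$, and let $\mathbb{D}=\mathrm{ran}(\varphi)\cap\mathrm{ran}(-\varphi)\subset\mathbb{C}$ (the intersection of two filled deltoids). For $\alpha\in\mathbb{C}$ let $f_\alpha(x)=x^3-\alpha x^2+\overline{\alpha}x-1$. Choice of roots: for $\alpha\in\mathbb{D}$ let $r_1,r_2,r_3$ be the roots of $f_\alpha$ and $q_1,q_2,q_3$ the roots of $f_{-\alpha}$, listed with multiplicity; all of them are unimodular. One takes $x$ to be any of the $r_i$ and $y$ to be any other one ($x=r_i$, $y=r_j$, $i\neq j$), and likewise $u=q_k$, $v=q_l$ with $k\neq l$. "Previously unknown" means that the families had not appeared in the literature as of the paper (March 2009). The paper's proof establishes this as follows: all families of complex Hadamard matrices of order $6$ known at that time contain fewer than two parameters, with the exception of the Fourier family $F_6(a,b)$ and its transpose $F_6^T(a,b)$ (the known two-parameter families through the Fourier matrix of order $6$ and its transpose); and in a small neighbourhood of $\alpha=1$ the family $X_6$ is disjoint from these two Fourier families, so that inside this neighbourhood only one-parameter curves can possibly produce already known matrices, while generically the matrices are new. "Non-affine" is the usual terminology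 for parametric families of complex Hadamard matrices: an affine family is one of the form $\{H\circ\mathrm{EXP}(\mathbf{i}R):R\in\mathcal{R}\}$, with $H$ a fixed complex Hadamard matrix, $\mathcal{R}$ a real linear space of real matrices with zero first row and column, $\circ$ the entrywise product and $\mathrm{EXP}$ the entrywise exponential; a family not of this kind is non-affine. *)

theory Defs
  imports "HOL-Analysis.Analysis" "HOL-Computational_Algebra.Polynomial"
begin

definition adjoint_matrix :: "complex^'n^'m \<Rightarrow> complex^'m^'n" where
  "adjoint_matrix A = (\<chi> i j. cnj (A $ j $ i))"

definition complex_hadamard :: "complex^'n^'n \<Rightarrow> bool" where
  "complex_hadamard H \<longleftrightarrow>
     (\<forall>i j. H $ i $ j \<in> sphere 0 1) \<and> H ** adjoint_matrix H = mat (of_nat CARD('n))"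

definition unitary_diagonal :: "complex^'n^'n \<Rightarrow> bool" where
  "unitary_diagonal A \<longleftrightarrow>
     (\<exists>d. (\<forall>i. d i \<in> sphere 0 1) \<and> A = (\<chi> i j. if i = j then d i else 0))"

definition permutation_matrix :: "complex^'n^'n \<Rightarrow> bool" where
  "permutation_matrix A \<longleftrightarrow> (\<exists>p. p permutes UNIV \<and> A = (\<chi> i j. if j = p i then 1 else 0))"

definition hadamard_equivalent :: "complex^'n^'n \<Rightarrow> complex^'n^'n \<Rightarrow> bool" where
  "hadamard_equivalent H K \<longleftrightarrow>
     (\<exists>D1 D2 P Q. unitary_diagonal D1 \<and> unitary_diagonal D2 \<and>
        permutation_matrix P \<and> permutation_matrix Q \<and> H = D1 ** P ** K ** Q ** D2)"


definition phi :: "complex \<Rightarrow> complex \<Rightarrow> complex" where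
  "phi x y = x + y + 1 / (x * y)"

definition deltoid_region :: "complex set" where
  "deltoid_region =
     {phi x y | x y. x \<in> sphere 0 1 \<and> y \<in> sphere 0 1} \<inter>
     {- phi x y | x y. x \<in> sphere 0 1 \<and> y \<in> sphere 0 1}"

text \<open>The cubic \<open>X^3 - \<alpha> X^2 + cnj \<alpha> X - 1\<close>; coefficients are listed from degree 0 upwards.\<close>

definition f_poly :: "complex \<Rightarrow> complex poly" where
  "f_poly \<alpha> = [:-1, cnj \<alpha>, -\<alpha>, 1:]"

text \<open>
  \<open>proots\<close> counts roots with multiplicity, so \<open>x\<close> and \<open>y\<close> sit at two different positions in the
  list of roots, but may coincide as numbers when the root is multiple.
\<close>

definition two_roots :: "complex \<Rightarrow> complex \<Rightarrow> complex \<Rightarrow> bool" where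
  "two_roots \<alpha> x y \<longleftrightarrow> {#x, y#} \<subseteq># proots (f_poly \<alpha>)"

definition X6 :: "complex \<Rightarrow> complex \<Rightarrow> complex \<Rightarrow> complex \<Rightarrow> complex^6^6" where
  "X6 x y u v = vector [
     vector [1, 1,           1,             1,               1,         1],
     vector [1, x^2 * y,     x * y^2,       x * y / (u * v),     u * x * y,     v * x * y],
     vector [1, x / y,       x^2 * y,       x / u,           x / v,     u * v * x],
     vector [1, u * v * x,       u * x * y,         -1,              -(u * x * y),  -(u * v * x)],
     vector [1, x / u,       v * x * y,         -(x / u),        -1,        -(v * x * y)],
     vector [1, x / v,       x * y / (u * v),   -(x * y / (u * v)),  -(x / v),  -1]]"

text \<open>
  The families as functions of the parameter \<open>\<alpha>\<close>. The value at \<open>\<alpha>\<close> is a (finite) set because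
  every admissible choice of the roots is allowed.
\<close>

definition X6_family :: "complex \<Rightarrow> (complex^6^6) set" where
  "X6_family \<alpha> = {X6 x y u v | x y u v. two_roots \<alpha> x y \<and> two_roots (-\<alpha>) u v}"

definition X6T_family :: "complex \<Rightarrow> (complex^6^6) set" where
  "X6T_family \<alpha> = {transpose (X6 x y u v) | x y u v. two_roots \<alpha> x y \<and> two_roots (-\<alpha>) u v}"


text \<open>
  A point of \<open>D \<subseteq> \<complex>\<close> amounts to two real parameters. Every point of the parameter region is a limit
  of interior points, over the interior the family is locally parametrized by real-differentiable
  branches, and the parameters are genuine: any given matrix is equivalent to
  members of the family for finitely many parameter values only.
\<close>

definition two_parameter_family :: "complex set \<Rightarrow> (complex \<Rightarrow> (complex^6^6) set) \<Rightarrow> bool" where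
  "two_parameter_family D F \<longleftrightarrow>
     interior D \<noteq> {} \<and> D \<subseteq> closure (interior D) \<and> (\<forall>\<alpha>\<in>D. F \<alpha> \<noteq> {}) \<and>
     (\<forall>\<alpha>\<^sub>0\<in>interior D. \<forall>H\<in>F \<alpha>\<^sub>0. \<exists>e>0. \<exists>G. ball \<alpha>\<^sub>0 e \<subseteq> D \<and> G differentiable_on ball \<alpha>\<^sub>0 e \<and>
        G \<alpha>\<^sub>0 = H \<and> (\<forall>\<alpha>\<in>ball \<alpha>\<^sub>0 e. G \<alpha> \<in> F \<alpha>)) \<and>
     (\<forall>K. finite {\<alpha>\<in>D. \<exists>H\<in>F \<alpha>. hadamard_equivalent H K})"

definition exp_deform :: "complex^6^6 \<Rightarrow> real^6^6 \<Rightarrow> complex^6^6" where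
  "exp_deform H R = (\<chi> i j. H $ i $ j * exp (\<i> * of_real (R $ i $ j)))"

definition affine_family :: "(complex^6^6) set \<Rightarrow> bool" where
  "affine_family \<F> \<longleftrightarrow>
     (\<exists>H \<R>. complex_hadamard H \<and> subspace \<R> \<and>
        (\<forall>R\<in>\<R>. (\<forall>k. R $ 1 $ k = 0) \<and> (\<forall>k. R $ k $ 1 = 0)) \<and>
        \<F> = {exp_deform H R | R. R \<in> \<R>})"

text \<open>
  Both readings of ``the family'' are covered: the set of all its members, and the set obtained
  from one fixed choice of roots for each parameter value.
\<close>

definition non_affine_family :: "complex set \<Rightarrow> (complex \<Rightarrow> (complex^6^6) set) \<Rightarrow> bool" where
  "non_affine_family D F \<longleftrightarrow>
     \<not> affine_family (\<Union>\<alpha>\<in>D. F \<alpha>) \<and>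
     (\<forall>G. (\<forall>\<alpha>\<in>D. G \<alpha> \<in> F \<alpha>) \<longrightarrow> \<not> affine_family (G ` D))"


text \<open>
  The Fourier family: entry \<open>(j, k)\<close> (counted from 0) of the Fourier matrix is \<open>w^(j k)\<close>, and the
  rows with odd \<open>j\<close> carry the free phases \<open>p\<close>, \<open>q\<close> in the columns \<open>k\<close> with \<open>k mod 3 = 1\<close>, \<open>k mod 3 = 2\<close>.
\<close>

definition F6 :: "real \<Rightarrow> real \<Rightarrow> complex^6^6" where
  "F6 a b = (let w = cis (pi / 3); p = cis a; q = cis b in vector [
     vector [1, 1,       1,        1,    1,        1],
     vector [1, w * p,   w^2 * q,  w^3,  w^4 * p,  w^5 * q],
     vector [1, w^2,     w^4,      w^6,  w^8,      w^10],
     vector [1, w^3 * p, w^6 * q,  w^9,  w^12 * p, w^15 * q],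
     vector [1, w^4,     w^8,      w^12, w^16,     w^20],
     vector [1, w^5 * p, w^10 * q, w^15, w^20 * p, w^25 * q]])"

text \<open>
  Sets of matrices with fewer than two real parameters: countable unions of differentiable curves.
  Isolated matrices are included as constant curves, and curves that are differentiable only
  piecewise are included by splitting their domain.
\<close>

definition fewer_than_two_parameters :: "(complex^6^6) set \<Rightarrow> bool" where
  "fewer_than_two_parameters \<K> \<longleftrightarrow>
     (\<exists>(I :: nat \<Rightarrow> real set) (K :: nat \<Rightarrow> real \<Rightarrow> complex^6^6).
        (\<forall>n. K n differentiable_on I n) \<and> \<K> = (\<Union>n. K n ` I n))"

text \<open>
  Mathematical content of ``previously unknown'': when the paper was written, every known family
  had fewer than two parameters, except for the Fourier family and its transpose. Near \<open>\<alpha> = 1\<close> the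
  family avoids these two exceptions altogether, and it meets any collection of matrices with
  fewer than two parameters, up to equivalence, only over a null set of parameters \<open>\<alpha>\<close>, whereas
  the neighbourhood of 1 in \<open>D\<close> is not a null set.
\<close>

definition previously_unknown_family :: "complex set \<Rightarrow> (complex \<Rightarrow> (complex^6^6) set) \<Rightarrow> bool" where
  "previously_unknown_family D F \<longleftrightarrow>
     (\<exists>\<epsilon>>0. 1 \<in> D \<and> \<not> negligible (D \<inter> ball 1 \<epsilon>) \<and>
        (\<forall>\<alpha>\<in>D \<inter> ball 1 \<epsilon>. \<forall>H\<in>F \<alpha>. \<forall>a b.
           \<not> hadamard_equivalent H (F6 a b) \<and> \<not> hadamard_equivalent H (transpose (F6 a b))) \<and>
        (\<forall>\<K>. fewer_than_two_parameters \<K> \<longrightarrow>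
           negligible {\<alpha> \<in> D \<inter> ball 1 \<epsilon>. \<exists>H\<in>F \<alpha>. \<exists>K\<in>\<K>. hadamard_equivalent H K}))"

end

theory Submission
  imports Defs "HOL-Computational_Algebra.Fundamental_Theorem_Algebra"
begin

text \<open>
  Up to nonzero factors, the inner products of two rows of \<open>X6 x y u v\<close> are zero, \<open>phi x y + phi u v\<close> or
  its conjugate, whence the Hadamard property. Transposing \<open>X6 x y u v\<close> amounts to replacing
  \<open>(x, y, u, v)\<close> by \<open>(x y, 1/y, 1/u, 1/v)\<close>, so the transposed family at \<open>\<alpha>\<close> is the family at \<open>cnj \<alpha>\<close>.
  The region is described by the discriminants of the two cubics; it is star-shaped, its interior is
  where both are negative, and there the inverse function theorem yields differentiable roots.
  Equivalent matrices have the same set of products \<open>H i j * H k l * cnj (H i l) * cnj (H k j)\<close>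
  (Haagerup), and two of these determine \<open>\<alpha>\<^sup>3\<close>. Therefore a matrix meets the family in finitely
  many parameters, and a curve of matrices meets it in a null set. For \<open>\<alpha> = 1\<close> all these products are
  fourth roots of unity, while a primitive cube root of unity occurs for every Fourier matrix
  \<open>F6 a b\<close>.
\<close>

section \<open>Indices, sums and vector entries in dimension six\<close>

lemma exhaust_6: "(i::6) = 1 \<or> i = 2 \<or> i = 3 \<or> i = 4 \<or> i = 5 \<or> i = 6"
proof (induct i)
  case (of_int z)
  then have "z = 0 \<or> z = 1 \<or> z = 2 \<or> z = 3 \<or> z = 4 \<or> z = 5" by fastforce
  then show ?case by auto
qed

lemma forall_6: "(\<forall>i::6. P i) \<longleftrightarrow> P 1 \<and> P 2 \<and> P 3 \<and> P 4 \<and> P 5 \<and> P 6"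
  by (metis exhaust_6)

lemma UNIV_6: "UNIV = {1, 2, 3, 4, 5, 6::6}"
  using exhaust_6 by auto

lemma sum_6: "sum f (UNIV::6 set) = f 1 + f 2 + f 3 + f 4 + f 5 + f 6"
  unfolding UNIV_6 by (simp add: ac_simps)

lemma vector_6:
  "(vector [a, b, c, d, e, f] :: 'a::zero^6) $ 1 = a"
  "(vector [a, b, c, d, e, f] :: 'a::zero^6) $ 2 = b"
  "(vector [a, b, c, d, e, f] :: 'a::zero^6) $ 3 = c"
  "(vector [a, b, c, d, e, f] :: 'a::zero^6) $ 4 = d"
  "(vector [a, b, c, d, e, f] :: 'a::zero^6) $ 5 = e"
  "(vector [a, b, c, d, e, f] :: 'a::zero^6) $ 6 = f"
  unfolding vector_def by simp_all

section \<open>Roots of the cubics and the deltoid region\<close>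

text \<open>These are Vieta's relations: the three roots have product 1, so the third one is
  \<open>1 / (x * y)\<close>, and the two equations compare the remaining coefficients. They do not
  by themselves force the roots onto the unit circle.\<close>

lemma two_roots_iff:
  "two_roots \<alpha> x y \<longleftrightarrow> x \<noteq> 0 \<and> y \<noteq> 0 \<and> phi x y = \<alpha> \<and> x * y + 1 / x + 1 / y = cnj \<alpha>"
proof
  assume "two_roots \<alpha> x y"
  then obtain M where M: "proots (f_poly \<alpha>) = {#x, y#} + M"
    unfolding two_roots_def by (metis subset_mset.add_diff_inverse)
  have "size (proots (f_poly \<alpha>)) = 3"
    by (simp add: size_proots_complex f_poly_def)
  with M have "size M = 1" by simp
  then obtain z where "M = {#z#}" using size_1_singleton_mset by blast
  with M have "proots (f_poly \<alpha>) = {#x, y, z#}" by simp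
  with complex_poly_decompose_multiset [of "f_poly \<alpha>"]
  have "f_poly \<alpha> = [:-x, 1:] * [:-y, 1:] * [:-z, 1:]"
    by (simp add: f_poly_def algebra_simps)
  also have "\<dots> = [:- (x * y * z), x * y + x * z + y * z, - (x + y + z), 1:]"
    by (simp add: algebra_simps)
  finally have e: "x * y * z = 1" "cnj \<alpha> = x * y + x * z + y * z" "- \<alpha> = - (x + y + z)"
    unfolding f_poly_def by simp_all
  from e(3) have e3: "\<alpha> = x + y + z" by (simp only: neg_equal_iff_equal)
  from e(1) have nz: "x \<noteq> 0" "y \<noteq> 0" by auto
  with e(1) have "z = 1 / (x * y)" by (simp add: field_simps)
  moreover from e(1) nz have "1 / x = y * z" "1 / y = x * z" by (simp_all add: field_simps)
  ultimately show "x \<noteq> 0 \<and> y \<noteq> 0 \<and> phi x y = \<alpha> \<and> x * y + 1 / x + 1 / y = cnj \<alpha>"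
    using e(2) e3 nz by (simp add: phi_def)
next
  assume a: "x \<noteq> 0 \<and> y \<noteq> 0 \<and> phi x y = \<alpha> \<and> x * y + 1 / x + 1 / y = cnj \<alpha>"
  then have "f_poly \<alpha> = [:-x, 1:] * [:-y, 1:] * [:- (1 / (x * y)), 1:]"
    by (auto simp: f_poly_def phi_def field_simps)
  moreover have "proots ([:-x, 1:] * [:-y, 1:] * [:- (1 / (x * y)), 1:]) = {#x, y, 1 / (x * y)#}"
    (is "proots (?A * ?B * ?C) = _")
  proof -
    have nz: "?A * ?B \<noteq> 0" "?C \<noteq> 0" "?A \<noteq> 0" "?B \<noteq> 0" by auto
    have "proots (?A * ?B * ?C) = proots ?A + proots ?B + proots ?C"
      unfolding proots_mult [OF nz(1,2)] proots_mult [OF nz(3,4)] ..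
    then show ?thesis by simp
  qed
  ultimately have "proots (f_poly \<alpha>) = {#x, y, 1 / (x * y)#}" by simp
  then show "two_roots \<alpha> x y" by (simp add: two_roots_def)
qed

text \<open>On the unit circle conjugation is inversion, which turns claims about conjugates into
  rational identities.\<close>

lemma unimodular_iff: "x \<in> sphere 0 1 \<longleftrightarrow> x \<noteq> 0 \<and> cnj x = 1 / (x::complex)"
proof
  assume "x \<in> sphere 0 1"
  then have "x * cnj x = 1" "x \<noteq> 0" by (auto simp: complex_norm_square [symmetric])
  then show "x \<noteq> 0 \<and> cnj x = 1 / x" by (simp add: field_simps)
next
  assume "x \<noteq> 0 \<and> cnj x = 1 / x"
  then have "x * cnj x = 1" by simp
  then have "(norm x)\<^sup>2 = 1" by (metis complex_norm_square of_real_eq_1_iff)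
  then have "norm x = 1 \<or> norm x = - 1" by (simp only: power2_eq_1_iff)
  with norm_ge_zero [of x] show "x \<in> sphere 0 1" by (auto simp del: norm_ge_zero)
qed

lemma cis_Arg_unimodular: "x \<in> sphere 0 1 \<Longrightarrow> cis (Arg x) = x"
  using cis_Arg [of x] by (cases "x = 0") (auto simp: sgn_div_norm)

lemma cnj_phi: "x \<in> sphere 0 1 \<Longrightarrow> y \<in> sphere 0 1 \<Longrightarrow> cnj (phi x y) = x * y + 1 / x + 1 / y"
  unfolding unimodular_iff phi_def by (auto simp: field_simps)

text \<open>For unimodular arguments the second Vieta relation is the conjugate of the
  first.\<close>

lemma two_roots_unimodular:
  "x \<in> sphere 0 1 \<Longrightarrow> y \<in> sphere 0 1 \<Longrightarrow> two_roots \<alpha> x y \<longleftrightarrow> phi x y = \<alpha>"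
  using cnj_phi by (auto simp: two_roots_iff)

lemma two_roots_root:
  assumes "two_roots \<alpha> x y"
  shows "x ^ 3 - \<alpha> * x\<^sup>2 + cnj \<alpha> * x - 1 = 0" "y ^ 3 - \<alpha> * y\<^sup>2 + cnj \<alpha> * y - 1 = 0"
proof -
  have "x \<noteq> 0" "y \<noteq> 0" and a: "\<alpha> = x + y + 1 / (x * y)" "cnj \<alpha> = x * y + 1 / x + 1 / y"
    using assms by (auto simp: two_roots_iff phi_def)
  then show "x ^ 3 - \<alpha> * x\<^sup>2 + cnj \<alpha> * x - 1 = 0" "y ^ 3 - \<alpha> * y\<^sup>2 + cnj \<alpha> * y - 1 = 0"
    \<comment> \<open>\<open>cnj \<alpha>\<close> has to be replaced first, since rewriting
      \<open>\<alpha>\<close> would also rewrite inside the conjugate.\<close>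
    unfolding a(2) unfolding a(1)
    by (simp_all add: field_simps power2_eq_square power3_eq_cube)
qed

text \<open>This is the discriminant of \<open>f_poly \<alpha>\<close>, which is real because \<open>f_poly \<alpha>\<close> is self-inversive.\<close>

definition deltoid_fun :: "complex \<Rightarrow> real" where
  "deltoid_fun \<alpha> = norm \<alpha> ^ 4 - 8 * Re (\<alpha> ^ 3) + 18 * (norm \<alpha>)\<^sup>2 - 27"

text \<open>Writing the squared norm as \<open>\<alpha> * cnj \<alpha>\<close> and the real part
  through \<open>\<alpha> ^ 3 + cnj \<alpha> ^ 3\<close> gives a polynomial in the coefficients.
  With the roots inserted, the claim is an identity modulo the relation that their product is
  1.\<close>

lemma deltoid_fun_disc:
  assumes "two_roots \<alpha> x y"
  shows "complex_of_real (deltoid_fun \<alpha>) = ((x - y) * (x - 1 / (x * y)) * (y - 1 / (x * y)))\<^sup>2"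
proof -
  have nz: "x \<noteq> 0" "y \<noteq> 0" and a: "\<alpha> = x + y + 1 / (x * y)" "cnj \<alpha> = x * y + 1 / x + 1 / y"
    using assms by (auto simp: two_roots_iff phi_def)
  have r: "complex_of_real (2 * Re (\<alpha> ^ 3)) = \<alpha> ^ 3 + cnj \<alpha> ^ 3"
    by (simp only: complex_add_cnj [symmetric] complex_cnj_power)
  have "complex_of_real (deltoid_fun \<alpha>) =
      (\<alpha> * cnj \<alpha>)\<^sup>2 - 4 * (\<alpha> ^ 3 + cnj \<alpha> ^ 3) + 18 * (\<alpha> * cnj \<alpha>) - 27"
    unfolding r [symmetric] complex_norm_square [symmetric] by (simp add: deltoid_fun_def)
  also have "\<dots> = ((x - y) * (x - 1 / (x * y)) * (y - 1 / (x * y)))\<^sup>2"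
  proof -
    obtain z where z: "z = 1 / (x * y)" by simp
    then have xyz: "x * y * z = 1" using nz by simp
    have "1 / x = y * z" "1 / y = x * z" using z nz by (auto simp: field_simps)
    then have a': "\<alpha> = x + y + z" "cnj \<alpha> = x * y + x * z + y * z" using a z by auto
    show ?thesis unfolding a'(2) z [symmetric] unfolding a'(1) using xyz by algebra
  qed
  finally show ?thesis .
qed

text \<open>Conjugation inverts each root. As the product of the roots is 1, the product
  \<open>P\<close> of their differences goes to \<open>- P\<close>; it is purely imaginary, and its
  square is minus its squared norm.\<close>

lemma deltoid_fun_unimodular:
  assumes "x \<in> sphere 0 1" "y \<in> sphere 0 1"
  shows "deltoid_fun (phi x y) = - (norm ((x - y) * (x - 1 / (x * y)) * (y - 1 / (x * y))))\<^sup>2"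
proof -
  define P where "P = (x - y) * (x - 1 / (x * y)) * (y - 1 / (x * y))"
  have nz: "x \<noteq> 0" "y \<noteq> 0" using assms by auto
  have c: "cnj x = 1 / x" "cnj y = 1 / y" using assms unfolding unimodular_iff by auto
  have "cnj P = - P" using nz by (simp add: P_def c, simp add: field_simps)
  then have "P\<^sup>2 = - (P * cnj P)" by (simp add: power2_eq_square)
  then have "P\<^sup>2 = complex_of_real (- (norm P)\<^sup>2)"
    unfolding complex_norm_square [symmetric] by simp
  moreover have "complex_of_real (deltoid_fun (phi x y)) = P\<^sup>2"
    unfolding P_def by (rule deltoid_fun_disc) (use assms two_roots_unimodular in blast)
  ultimately have "complex_of_real (deltoid_fun (phi x y)) = complex_of_real (- (norm P)\<^sup>2)" by simp
  then show ?thesis unfolding P_def of_real_eq_iff .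
qed

lemma two_roots_swap: "two_roots \<alpha> x y \<Longrightarrow> two_roots \<alpha> y x"
  by (auto simp: two_roots_iff phi_def field_simps)

lemma two_roots_third: "two_roots \<alpha> x y \<Longrightarrow> two_roots \<alpha> x (1 / (x * y))"
  by (auto simp: two_roots_iff phi_def field_simps)

lemma two_roots_exist: obtains x y where "two_roots \<alpha> x y"
proof -
  have "size (proots (f_poly \<alpha>)) = Suc (Suc 1)"
    by (simp add: size_proots_complex f_poly_def)
  then obtain x N where N: "proots (f_poly \<alpha>) = add_mset x N"
    using size_eq_Suc_imp_eq_union by blast
  with \<open>size _ = _\<close> have "size N = Suc 1" by simp
  then obtain y M where "N = add_mset y M"
    using size_eq_Suc_imp_eq_union by blast
  with N have "two_roots \<alpha> x y" by (simp add: two_roots_def)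
  then show ?thesis by (rule that)
qed

text \<open>
  The roots are permuted by \<open>x \<mapsto> 1 / cnj x\<close>. A root off the unit circle is thus accompanied by a
  different second one, and then the product of the differences of the roots is real and nonzero.
\<close>

lemma deltoid_fun_nonpos_unimodular:
  assumes "two_roots \<alpha> x y" "deltoid_fun \<alpha> \<le> 0"
  shows "x \<in> sphere 0 1"
proof (rule ccontr)
  assume x1: "x \<notin> sphere 0 1"
  define w where "w = 1 / cnj x"
  have nz: "x \<noteq> 0" "y \<noteq> 0" and a: "\<alpha> = x + y + 1 / (x * y)" "cnj \<alpha> = x * y + 1 / x + 1 / y"
    using assms(1) by (auto simp: two_roots_iff phi_def)
  have "cnj (x ^ 3 - \<alpha> * x\<^sup>2 + cnj \<alpha> * x - 1) = 0"
    using two_roots_root [OF assms(1)] by simp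
  then have "w ^ 3 - \<alpha> * w\<^sup>2 + cnj \<alpha> * w - 1 = 0"
    using nz by (simp add: w_def field_simps power2_eq_square power3_eq_cube)
  moreover have "(w - x) * (w - y) * (w - 1 / (x * y)) = w ^ 3 - \<alpha> * w\<^sup>2 + cnj \<alpha> * w - 1"
    using nz unfolding a(2) unfolding a(1)
    by (simp add: field_simps power2_eq_square power3_eq_cube)
  moreover have "w \<noteq> x"
    using x1 nz unfolding unimodular_iff by (auto simp: w_def field_simps)
  \<comment> \<open>The reflected point \<open>w\<close> is again a root; being different from
    \<open>x\<close>, it is one of the other two.\<close>
  ultimately have "w = y \<or> w = 1 / (x * y)" by simp
  then have tr: "two_roots \<alpha> x w"
    using assms(1) two_roots_third by metis
  define P where "P = (x - w) * (x - 1 / (x * w)) * (w - 1 / (x * w))"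
  \<comment> \<open>Conjugation sends \<open>x\<close>, \<open>w\<close> and the third root to the
    inverses of \<open>w\<close>, \<open>x\<close> and the third root. The signs cancel, so
    \<open>P\<close> is real.\<close>
  have "cnj P = P"
    using nz by (simp add: P_def w_def field_simps)
  then have P: "P = complex_of_real (Re P)"
    by (metis Reals_cnj_iff of_real_Re)
  have "complex_of_real (deltoid_fun \<alpha>) = P\<^sup>2"
    unfolding P_def by (rule deltoid_fun_disc [OF tr])
  also have "\<dots> = complex_of_real ((Re P)\<^sup>2)"
    by (subst P) simp
  finally have "deltoid_fun \<alpha> = (Re P)\<^sup>2" unfolding of_real_eq_iff .
  with assms(2) have "Re P = 0" by simp
  with P have "P = 0" by simp
  \<comment> \<open>The third root \<open>1 / (x * w)\<close> equals \<open>cnj x / x\<close>, which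
    has modulus 1, unlike \<open>x\<close> and \<open>w\<close>; so neither alternative can
    hold.\<close>
  with \<open>w \<noteq> x\<close> have "x = cnj x / x \<or> 1 / cnj x = cnj x / x"
    by (simp add: P_def w_def)
  then have "norm x = norm (cnj x / x) \<or> norm (1 / cnj x) = norm (cnj x / x)" by metis
  with x1 nz show False by (auto simp: norm_divide)
qed

lemma deltoid_fun_nonpos_iff:
  "deltoid_fun \<alpha> \<le> 0 \<longleftrightarrow> (\<exists>x y. x \<in> sphere 0 1 \<and> y \<in> sphere 0 1 \<and> \<alpha> = phi x y)"
proof
  assume d: "deltoid_fun \<alpha> \<le> 0"
  obtain x y where xy: "two_roots \<alpha> x y" by (rule two_roots_exist)
  then have "\<alpha> = phi x y" by (simp add: two_roots_iff)
  with d xy show "\<exists>x y. x \<in> sphere 0 1 \<and> y \<in> sphere 0 1 \<and> \<alpha> = phi x y"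
    using deltoid_fun_nonpos_unimodular two_roots_swap by metis
qed (auto simp: deltoid_fun_unimodular)

section \<open>The region as a star-shaped sublevel set\<close>

lemma mem_deltoid_region: "\<alpha> \<in> deltoid_region \<longleftrightarrow> deltoid_fun \<alpha> \<le> 0 \<and> deltoid_fun (- \<alpha>) \<le> 0"
proof -
  have "\<alpha> = - phi x y \<longleftrightarrow> - \<alpha> = phi x y" for x y by (metis minus_minus)
  then show ?thesis unfolding deltoid_region_def deltoid_fun_nonpos_iff by auto
qed

lemma deltoid_region_two_roots:
  assumes "\<alpha> \<in> deltoid_region"
  shows "two_roots \<alpha> x y \<Longrightarrow> x \<in> sphere 0 1 \<and> y \<in> sphere 0 1"
    and "two_roots (- \<alpha>) x y \<Longrightarrow> x \<in> sphere 0 1 \<and> y \<in> sphere 0 1"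
  using assms unfolding mem_deltoid_region
  by (metis deltoid_fun_nonpos_unimodular two_roots_swap)+

text \<open>Negating \<open>\<alpha>\<close> only flips the sign of the cubic term, so the two
  discriminant conditions merge into one with an absolute value.\<close>

lemma deltoid_region_abs:
  "\<alpha> \<in> deltoid_region \<longleftrightarrow> norm \<alpha> ^ 4 + 8 * \<bar>Re (\<alpha> ^ 3)\<bar> + 18 * (norm \<alpha>)\<^sup>2 \<le> 27"
  unfolding mem_deltoid_region deltoid_fun_def by auto

definition deltoid_interior :: "complex set" where
  "deltoid_interior = {\<alpha>. deltoid_fun \<alpha> < 0 \<and> deltoid_fun (- \<alpha>) < 0}"

lemma deltoid_interior_abs:
  "\<alpha> \<in> deltoid_interior \<longleftrightarrow> norm \<alpha> ^ 4 + 8 * \<bar>Re (\<alpha> ^ 3)\<bar> + 18 * (norm \<alpha>)\<^sup>2 < 27"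
  unfolding deltoid_interior_def deltoid_fun_def by auto

text \<open>Every term on the left of the defining inequality is homogeneous of degree at least 2,
  so scaling by \<open>t\<close> multiplies the left side by at most the square of \<open>t\<close>,
  which makes the inequality strict.\<close>

lemma deltoid_region_shrink:
  assumes "\<alpha> \<in> deltoid_region" "0 \<le> t" "t < 1"
  shows "of_real t * \<alpha> \<in> deltoid_interior"
proof -
  have t: "t ^ 4 \<le> t\<^sup>2" "t ^ 3 \<le> t\<^sup>2" "t\<^sup>2 < 1"
    using assms by (auto intro: power_decreasing simp: power_less_one_iff abs_square_less_1)
  have "norm (of_real t * \<alpha>) ^ 4 + 8 * \<bar>Re ((of_real t * \<alpha>) ^ 3)\<bar> + 18 * (norm (of_real t * \<alpha>))\<^sup>2
      = t ^ 4 * norm \<alpha> ^ 4 + 8 * (t ^ 3 * \<bar>Re (\<alpha> ^ 3)\<bar>) + 18 * (t\<^sup>2 * (norm \<alpha>)\<^sup>2)"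
    using assms by (simp add: norm_mult power_mult_distrib abs_mult flip: of_real_power)
  also have "\<dots> \<le> t\<^sup>2 * norm \<alpha> ^ 4 + 8 * (t\<^sup>2 * \<bar>Re (\<alpha> ^ 3)\<bar>) + 18 * (t\<^sup>2 * (norm \<alpha>)\<^sup>2)"
    by (intro add_mono mult_left_mono mult_right_mono t) auto
  also have "\<dots> = t\<^sup>2 * (norm \<alpha> ^ 4 + 8 * \<bar>Re (\<alpha> ^ 3)\<bar> + 18 * (norm \<alpha>)\<^sup>2)"
    by (simp add: algebra_simps)
  also have "\<dots> \<le> t\<^sup>2 * 27"
    using assms(1) unfolding deltoid_region_abs by (intro mult_left_mono) auto
  also have "\<dots> < 27" using t by simp
  finally show ?thesis unfolding deltoid_interior_abs .
qed

lemma open_deltoid_interior: "open deltoid_interior"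
  unfolding deltoid_interior_def deltoid_fun_def
  by (intro open_Collect_conj open_Collect_less continuous_intros)

lemma interior_deltoid_region: "interior deltoid_region = deltoid_interior"
proof
  have "deltoid_interior \<subseteq> deltoid_region"
    by (auto simp: deltoid_interior_def mem_deltoid_region)
  then show "deltoid_interior \<subseteq> interior deltoid_region"
    by (simp add: interior_maximal open_deltoid_interior)
next
  show "interior deltoid_region \<subseteq> deltoid_interior"
  proof
    fix \<alpha> assume "\<alpha> \<in> interior deltoid_region"
    then obtain e where e: "e > 0" "ball \<alpha> e \<subseteq> deltoid_region" by (auto simp: mem_interior)
    \<comment> \<open>Moving \<open>\<alpha>\<close> outwards by the factor \<open>1 + d\<close>
      stays inside the ball, and shrinking back lands in the strict sublevel set. The added 1 avoids
      division by zero at the origin.\<close>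
    define d where "d = e / (norm \<alpha> + 1) / 2"
    have n: "norm \<alpha> + 1 > 0" by (simp add: add_nonneg_pos)
    then have d: "d > 0" using e by (simp add: d_def)
    have "d * norm \<alpha> < e"
      using e n by (simp add: d_def field_simps) (smt (verit) mult_nonneg_nonneg norm_ge_zero)
    then have "of_real (1 + d) * \<alpha> \<in> ball \<alpha> e"
      using d by (simp add: dist_norm algebra_simps norm_mult)
    then have "of_real (1 / (1 + d)) * (of_real (1 + d) * \<alpha>) \<in> deltoid_interior"
      using e d by (intro deltoid_region_shrink) auto
    moreover have "of_real (1 / (1 + d)) * (of_real (1 + d) * \<alpha>) = \<alpha>"
    proof -
      have "(1 / (1 + d)) * (1 + d) = 1" using d by simp
      then show ?thesis unfolding mult.assoc [symmetric] of_real_mult [symmetric] by simp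
    qed
    ultimately show "\<alpha> \<in> deltoid_interior" by simp
  qed
qed

lemma zero_in_deltoid_interior: "0 \<in> deltoid_interior"
  by (simp add: deltoid_interior_def deltoid_fun_def)

lemma deltoid_region_subset_closure: "deltoid_region \<subseteq> closure deltoid_interior"
proof
  fix \<alpha> assume a: "\<alpha> \<in> deltoid_region"
  have "(\<lambda>n. of_real (1 - inverse (real (Suc n))) * \<alpha>) \<longlonglongrightarrow> of_real (1 - 0) * \<alpha>"
    by (intro tendsto_intros LIMSEQ_inverse_real_of_nat)
  then have "(\<lambda>n. of_real (1 - inverse (real (Suc n))) * \<alpha>) \<longlonglongrightarrow> \<alpha>" by simp
  moreover have "of_real (1 - inverse (real (Suc n))) * \<alpha> \<in> deltoid_interior" for n
    using a by (intro deltoid_region_shrink) (auto simp: field_simps)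
  ultimately show "\<alpha> \<in> closure deltoid_interior"
    unfolding closure_sequential by (intro exI conjI allI)
qed

section \<open>The Hadamard property and transposition\<close>

text \<open>The diagonal of the product with the adjoint is automatic for unimodular entries; only
  orthogonality of distinct rows remains.\<close>

lemma complex_hadamard_iff:
  "complex_hadamard (H :: complex^'n^'n) \<longleftrightarrow> (\<forall>i j. H $ i $ j \<in> sphere 0 1) \<and>
     (\<forall>i j. i \<noteq> j \<longrightarrow> (\<Sum>k\<in>UNIV. H $ i $ k * cnj (H $ j $ k)) = 0)"
proof -
  have "(\<Sum>k\<in>UNIV. H $ i $ k * cnj (H $ i $ k)) = of_nat CARD('n)"
    if "\<forall>i j. H $ i $ j \<in> sphere 0 1" for i
    using that by (simp add: complex_norm_square [symmetric])
  then show ?thesis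
    unfolding complex_hadamard_def adjoint_matrix_def matrix_matrix_mult_def mat_def
    by (auto simp: vec_eq_iff)
qed

lemmas X6_nth = X6_def vector_6

lemma X6_hadamard:
  assumes "x \<in> sphere 0 1" "y \<in> sphere 0 1" "u \<in> sphere 0 1" "v \<in> sphere 0 1"
    and E: "phi x y + phi u v = 0"
  shows "complex_hadamard (X6 x y u v)"
proof -
  have nz: "x \<noteq> 0" "y \<noteq> 0" "u \<noteq> 0" "v \<noteq> 0" using assms by auto
  have c: "cnj x = 1 / x" "cnj y = 1 / y" "cnj u = 1 / u" "cnj v = 1 / v"
    using assms unfolding unimodular_iff by auto
  have E': "x * y + 1 / x + 1 / y + (u * v + 1 / u + 1 / v) = 0"
    using arg_cong [OF E, of cnj] cnj_phi assms(1-4) by simp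
  define S where "S = (\<lambda>i j. \<Sum>k\<in>UNIV. X6 x y u v $ i $ k * cnj (X6 x y u v $ j $ k))"
  note defs = S_def sum_6 X6_nth phi_def c
  note simps = field_simps power2_eq_square
  \<comment> \<open>Only pairs below the diagonal are computed; the others follow by conjugation.
    Inner products between the first three and the last three rows vanish identically, while those
    within each half are multiples of the relation or of its conjugate.\<close>
  have eqs: "S 2 1 = x * y * (phi x y + phi u v)"
    "S 3 1 = x * (x * y + 1 / x + 1 / y + (u * v + 1 / u + 1 / v))"
    "S 3 2 = (phi x y + phi u v) / y"
    "S 4 1 = 0" "S 4 2 = 0" "S 4 3 = 0" "S 5 1 = 0" "S 5 2 = 0" "S 5 3 = 0"
    "S 5 4 = (phi x y + phi u v) / u"
    "S 6 1 = 0" "S 6 2 = 0" "S 6 3 = 0"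
    "S 6 4 = (x * y + 1 / x + 1 / y + (u * v + 1 / u + 1 / v)) / (u * v)"
    "S 6 5 = (phi x y + phi u v) / v"
    using nz by (simp add: defs, (simp add: simps)?)+
  have sym: "S j i = cnj (S i j)" for i j
    by (simp add: S_def mult.commute)
  have low: "S 2 1 = 0" "S 3 1 = 0" "S 3 2 = 0" "S 5 4 = 0" "S 6 4 = 0" "S 6 5 = 0"
    unfolding eqs E E' by simp_all
  have up: "S 1 2 = 0" "S 1 3 = 0" "S 2 3 = 0" "S 4 5 = 0" "S 4 6 = 0" "S 5 6 = 0"
    "S 1 4 = 0" "S 2 4 = 0" "S 3 4 = 0" "S 1 5 = 0" "S 2 5 = 0" "S 3 5 = 0"
    "S 1 6 = 0" "S 2 6 = 0" "S 3 6 = 0"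
    by (subst sym, simp add: low eqs)+
  have "\<forall>i j. i \<noteq> j \<longrightarrow> S i j = 0"
    unfolding forall_6 using eqs low up by simp
  moreover have "\<forall>i j. X6 x y u v $ i $ j \<in> sphere 0 1"
    unfolding forall_6 using assms
    by (simp add: X6_nth norm_mult norm_divide norm_power)
  ultimately show ?thesis unfolding complex_hadamard_iff S_def by blast
qed

lemma transpose_X6:
  assumes "x \<noteq> 0" "y \<noteq> 0" "u \<noteq> 0" "v \<noteq> 0"
  shows "transpose (X6 x y u v) = X6 (x * y) (1 / y) (1 / u) (1 / v)"
  unfolding vec_eq_iff forall_6 using assms
  by (simp add: transpose_def X6_nth field_simps power2_eq_square)

text \<open>The roots for \<open>cnj \<alpha>\<close> are the inverses of those for
  \<open>\<alpha>\<close>, namely \<open>1 / x\<close>, \<open>1 / y\<close> and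
  \<open>x * y\<close>; both claims pick two of them.\<close>

lemma two_roots_cnj:
  assumes "two_roots \<alpha> x y"
  shows "two_roots (cnj \<alpha>) (x * y) (1 / y)" "two_roots (cnj \<alpha>) (1 / x) (1 / y)"
  using assms by (auto simp: two_roots_iff phi_def field_simps)

lemma X6T_family_eq: "X6T_family \<alpha> = X6_family (cnj \<alpha>)"
proof
  show "X6T_family \<alpha> \<subseteq> X6_family (cnj \<alpha>)"
  proof
    fix M assume "M \<in> X6T_family \<alpha>"
    then obtain x y u v where r: "two_roots \<alpha> x y" "two_roots (- \<alpha>) u v"
      and M: "M = transpose (X6 x y u v)"
      unfolding X6T_family_def by blast
    have "M = X6 (x * y) (1 / y) (1 / u) (1 / v)"
      unfolding M using r by (intro transpose_X6) (auto simp: two_roots_iff)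
    moreover have "two_roots (cnj \<alpha>) (x * y) (1 / y)" "two_roots (- cnj \<alpha>) (1 / u) (1 / v)"
      using two_roots_cnj r by fastforce+
    ultimately show "M \<in> X6_family (cnj \<alpha>)" unfolding X6_family_def by blast
  qed
next
  show "X6_family (cnj \<alpha>) \<subseteq> X6T_family \<alpha>"
  proof
    fix M assume "M \<in> X6_family (cnj \<alpha>)"
    then obtain x y u v where r: "two_roots (cnj \<alpha>) x y" "two_roots (- cnj \<alpha>) u v"
      and M: "M = X6 x y u v"
      unfolding X6_family_def by blast
    have nz: "x \<noteq> 0" "y \<noteq> 0" "u \<noteq> 0" "v \<noteq> 0" using r by (auto simp: two_roots_iff)
    \<comment> \<open>The substitution describing transposition is an involution, so it also
      provides the preimage of \<open>M\<close>.\<close>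
    then have "transpose (X6 (x * y) (1 / y) (1 / u) (1 / v)) = M"
      unfolding M by (subst transpose_X6) auto
    moreover have "two_roots \<alpha> (x * y) (1 / y)" "two_roots (- \<alpha>) (1 / u) (1 / v)"
      using two_roots_cnj r by fastforce+
    ultimately show "M \<in> X6T_family \<alpha>" unfolding X6T_family_def by blast
  qed
qed

section \<open>The Haagerup set\<close>

definition haagerup_set :: "complex^'n^'n \<Rightarrow> complex set" where
  "haagerup_set H = (\<lambda>(i, j, k, l). H $ i $ j * H $ k $ l * cnj (H $ i $ l) * cnj (H $ k $ j)) ` UNIV"

lemma haagerup_setI: "H $ i $ j * H $ k $ l * cnj (H $ i $ l) * cnj (H $ k $ j) \<in> haagerup_set H"
  unfolding haagerup_set_def by (rule image_eqI [where x = "(i, j, k, l)"]) auto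

lemma haagerup_setE:
  assumes "z \<in> haagerup_set H"
  obtains i j k l where "z = H $ i $ j * H $ k $ l * cnj (H $ i $ l) * cnj (H $ k $ j)"
  using assms unfolding haagerup_set_def by auto

lemma finite_haagerup_set: "finite (haagerup_set H)"
  unfolding haagerup_set_def by simp

text \<open>Transposition only renames the quadruple of indices; one inclusion suffices, as it can
  be applied to the transpose as well.\<close>

lemma haagerup_set_transpose: "haagerup_set (transpose H) = haagerup_set H"
proof -
  have *: "haagerup_set (transpose H) \<subseteq> haagerup_set H" for H :: "complex^'a^'a"
  proof
    fix z assume "z \<in> haagerup_set (transpose H)"
    then obtain i j k l where
      "z = transpose H $ i $ j * transpose H $ k $ l * cnj (transpose H $ i $ l) * cnj (transpose H $ k $ j)"
      by (rule haagerup_setE)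
    then have "z = H $ j $ i * H $ l $ k * cnj (H $ j $ k) * cnj (H $ l $ i)"
      by (simp add: transpose_def mult_ac)
    then show "z \<in> haagerup_set H" using haagerup_setI by metis
  qed
  from * [of H] * [of "transpose H"] show ?thesis unfolding transpose_transpose by (intro equalityI)
qed

section \<open>Equivalence in terms of entries and invariance of the Haagerup set\<close>

lemma diagonal_matrix_mult_nth:
  fixes A :: "'a::semiring_1^'n^'n"
  shows "((\<chi> i j. if i = j then d i else 0) ** A) $ i $ j = d i * A $ i $ j"
    and "(A ** (\<chi> i j. if i = j then d i else 0)) $ i $ j = A $ i $ j * d j"
  by (simp_all add: matrix_matrix_mult_def if_distrib [of "\<lambda>x. _ * x"]
      if_distrib [of "\<lambda>x. x * _"] cong: if_cong)

lemma permutation_matrix_mult_nth: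
  fixes A :: "'a::semiring_1^'n^'n"
  shows "((\<chi> i j. if j = p i then 1 else 0) ** A) $ i $ j = A $ p i $ j"
    and "p permutes UNIV \<Longrightarrow> (A ** (\<chi> i j. if j = p i then 1 else 0)) $ i $ j = A $ i $ inv p j"
proof -
  assume p: "p permutes UNIV"
  have "j = p i \<longleftrightarrow> i = inv p j" for i j
    using p by (metis permutes_inverses)
  then show "(A ** (\<chi> i j. if j = p i then 1 else 0)) $ i $ j = A $ i $ inv p j"
    by (simp add: matrix_matrix_mult_def if_distrib [of "\<lambda>x. _ * x"] cong: if_cong)
qed (simp add: matrix_matrix_mult_def if_distrib [of "\<lambda>x. x * _"] cong: if_cong)

lemma hadamard_equivalent_nth:
  fixes H K :: "complex^'n^'n"
  assumes "hadamard_equivalent H K"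
  obtains d e p q where "\<And>i. d i \<in> sphere 0 1" "\<And>j. e j \<in> sphere 0 1" "surj p" "surj q"
    "\<And>i j. H $ i $ j = d i * K $ p i $ q j * e j"
proof -
  from assms obtain d e p q where de: "\<forall>i. d i \<in> sphere 0 1" "\<forall>i. e i \<in> sphere 0 1"
    and p: "p permutes UNIV" and q: "q permutes UNIV"
    and H: "H = (\<chi> i j. if i = j then d i else 0) ** (\<chi> i j. if j = p i then 1 else 0) ** K **
       (\<chi> i j. if j = q i then 1 else 0) ** (\<chi> i j. if i = j then e i else 0)"
    unfolding hadamard_equivalent_def unitary_diagonal_def permutation_matrix_def by blast
  have "H $ i $ j = d i * K $ p i $ inv q j * e j" for i j
    unfolding H diagonal_matrix_mult_nth(2) permutation_matrix_mult_nth(2) [OF q]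
    unfolding matrix_mul_assoc [symmetric] diagonal_matrix_mult_nth(1) permutation_matrix_mult_nth(1) ..
  moreover have "surj p" "surj (inv q)"
    using p permutes_inv [OF q] by (simp_all add: permutes_surj)
  ultimately show ?thesis using that de by blast
qed

text \<open>Each row and column phase meets its own conjugate in the product and cancels, and the
  permutations merely relabel the quadruples.\<close>

lemma haagerup_set_equivalent:
  assumes "hadamard_equivalent H K"
  shows "haagerup_set H = haagerup_set K"
proof -
  from assms obtain d e p q where de: "\<And>i. d i \<in> sphere 0 1" "\<And>j. e j \<in> sphere 0 1"
    and surj: "surj p" "surj q"
    and H: "\<And>i j. H $ i $ j = d i * K $ p i $ q j * e j"
    by (rule hadamard_equivalent_nth) blast
  have one: "d i * cnj (d i) = 1" "e i * cnj (e i) = 1" for i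
    using de by (auto simp: complex_norm_square [symmetric])
  have *: "H $ i $ j * H $ k $ l * cnj (H $ i $ l) * cnj (H $ k $ j) =
     K $ p i $ q j * K $ p k $ q l * cnj (K $ p i $ q l) * cnj (K $ p k $ q j)" for i j k l
  proof -
    have "H $ i $ j * H $ k $ l * cnj (H $ i $ l) * cnj (H $ k $ j) =
       (d i * cnj (d i)) * (d k * cnj (d k)) * (e j * cnj (e j)) * (e l * cnj (e l)) *
       (K $ p i $ q j * K $ p k $ q l * cnj (K $ p i $ q l) * cnj (K $ p k $ q j))"
      unfolding H by (simp only: complex_cnj_mult mult_ac)
    then show ?thesis unfolding one by simp
  qed
  show ?thesis
  proof (intro equalityI subsetI)
    fix z assume "z \<in> haagerup_set H"
    then obtain i j k l where "z = H $ i $ j * H $ k $ l * cnj (H $ i $ l) * cnj (H $ k $ j)"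
      by (rule haagerup_setE)
    then show "z \<in> haagerup_set K" unfolding * by (simp only: haagerup_setI)
  next
    fix z assume "z \<in> haagerup_set K"
    then obtain i j k l where z: "z = K $ i $ j * K $ k $ l * cnj (K $ i $ l) * cnj (K $ k $ j)"
      by (rule haagerup_setE)
    from surj obtain i' j' k' l' where "i = p i'" "j = q j'" "k = p k'" "l = q l'"
      by (metis surjD)
    then show "z \<in> haagerup_set H" unfolding z by (simp only: haagerup_setI * [symmetric])
  qed
qed

text \<open>The quadruple \<open>(1, 1, i, j)\<close> reduces the product to the entry itself, so
  the entries of a normalized matrix are visible to the invariant.\<close>

lemma haagerup_set_normalized:
  assumes "\<And>k. H $ 1 $ k = 1" "\<And>k. H $ k $ 1 = (1::complex)"
  shows "H $ i $ j \<in> haagerup_set H"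
  using haagerup_setI [of H 1 1 i j] assms by simp

lemma X6_normalized: "X6 x y u v $ 1 $ k = 1" "X6 x y u v $ k $ 1 = 1"
  using exhaust_6 [of k] by (auto simp: X6_nth)

text \<open>
  The entries \<open>p = x\<^sup>2 y\<close> and \<open>q = x y\<^sup>2\<close> satisfy \<open>\<alpha> x y = 1 + p + q\<close> and \<open>(x y)\<^sup>3 = p q\<close>.
\<close>

lemma X6_family_cube:
  assumes "\<alpha> \<in> deltoid_region" "H \<in> X6_family \<alpha>"
  shows "\<alpha> ^ 3 = (1 + H $ 2 $ 2 + H $ 2 $ 3) ^ 3 * cnj (H $ 2 $ 2 * H $ 2 $ 3)"
proof -
  from assms(2) obtain x y u v where r: "two_roots \<alpha> x y" and H: "H = X6 x y u v"
    unfolding X6_family_def by blast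
  then have u: "x \<in> sphere 0 1" "y \<in> sphere 0 1"
    using deltoid_region_two_roots assms(1) by blast+
  then have nz: "x \<noteq> 0" "y \<noteq> 0" and c: "cnj x = 1 / x" "cnj y = 1 / y"
    unfolding unimodular_iff by auto
  have "\<alpha> = phi x y" using r by (simp add: two_roots_iff)
  then have "\<alpha> = (1 + H $ 2 $ 2 + H $ 2 $ 3) / (x * y)"
    using nz by (simp add: H X6_nth phi_def field_simps power2_eq_square)
  moreover have "cnj (H $ 2 $ 2 * H $ 2 $ 3) = 1 / (x * y) ^ 3"
    using nz by (simp add: H X6_nth c field_simps power2_eq_square power3_eq_cube)
  ultimately show ?thesis by (simp add: power_divide)
qed

lemma X6_family_normalized:
  assumes "H \<in> X6_family \<alpha>" shows "H $ 1 $ k = 1" "H $ k $ 1 = 1"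
  using assms X6_normalized unfolding X6_family_def by auto

text \<open>The two entries that determine \<open>\<alpha> ^ 3\<close> lie in the Haagerup set of
  \<open>H\<close>, which is that of \<open>K\<close>. Thus \<open>\<alpha> ^ 3\<close> is confined
  to values computed from \<open>K\<close> alone.\<close>

lemma X6_family_equivalent_cube:
  assumes "\<alpha> \<in> deltoid_region" "H \<in> X6_family \<alpha>" "hadamard_equivalent H K"
  shows "\<exists>p\<in>haagerup_set K. \<exists>q\<in>haagerup_set K. \<alpha> ^ 3 = (1 + p + q) ^ 3 * cnj (p * q)"
proof (intro bexI)
  show "\<alpha> ^ 3 = (1 + H $ 2 $ 2 + H $ 2 $ 3) ^ 3 * cnj (H $ 2 $ 2 * H $ 2 $ 3)"
    by (rule X6_family_cube [OF assms(1,2)])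
  have "H $ i $ j \<in> haagerup_set H" for i j
    by (intro haagerup_set_normalized X6_family_normalized [OF assms(2)])
  then show "H $ 2 $ 2 \<in> haagerup_set K" "H $ 2 $ 3 \<in> haagerup_set K"
    using haagerup_set_equivalent [OF assms(3)] by blast+
qed

text \<open>There are finitely many pairs in the Haagerup set of \<open>K\<close>, and each
  prescribes a cube with at most three roots.\<close>

lemma finite_X6_family_parameters:
  "finite {\<alpha>\<in>deltoid_region. \<exists>H\<in>X6_family \<alpha>. hadamard_equivalent H K}"
proof (rule finite_subset)
  let ?A = "haagerup_set K"
  show "{\<alpha>\<in>deltoid_region. \<exists>H\<in>X6_family \<alpha>. hadamard_equivalent H K} \<subseteq>
      (\<Union>p\<in>?A. \<Union>q\<in>?A. {\<alpha>. \<alpha> ^ 3 = (1 + p + q) ^ 3 * cnj (p * q)})"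
    using X6_family_equivalent_cube by blast
  show "finite (\<Union>p\<in>?A. \<Union>q\<in>?A. {\<alpha>. \<alpha> ^ 3 = (1 + p + q) ^ 3 * cnj (p * q)})"
    by (intro finite_UN_I finite_haagerup_set finite_nth_roots) simp
qed

section \<open>Curves of matrices and affine families\<close>

text \<open>Away from 0 the derivative of the cube is injective, so preimages of null sets are null;
  the origin adds a single point.\<close>

lemma negligible_cube_vimage:
  assumes "negligible N"
  shows "negligible {\<alpha>::complex. \<alpha> ^ 3 \<in> N}"
proof -
  have "negligible {\<alpha> \<in> - {0::complex}. \<alpha> ^ 3 \<in> N}"
  proof (rule negligible_differentiable_vimage [OF assms])
    show "((\<lambda>\<alpha>. \<alpha> ^ 3) has_derivative (\<lambda>h. h * (3 * \<alpha>\<^sup>2))) (at \<alpha> within - {0})" for \<alpha> :: complex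
      by (auto intro!: derivative_eq_intros simp: fun_eq_iff)
    show "inj (\<lambda>h. h * (3 * \<alpha>\<^sup>2))" if "\<alpha> \<in> - {0}" for \<alpha> :: complex
      using that by (auto intro: injI)
  qed
  then have "negligible (insert 0 {\<alpha> \<in> - {0::complex}. \<alpha> ^ 3 \<in> N})" by simp
  then show ?thesis by (rule negligible_subset) auto
qed

text \<open>The cubes lie on a differentiable image of a subset of the line, which is null in the
  plane; its preimage under cubing is null too.\<close>

lemma negligible_cube_curve:
  fixes p q :: "real \<Rightarrow> complex"
  assumes "p differentiable_on I" "q differentiable_on I"
  shows "negligible {\<alpha>. \<exists>t\<in>I. \<alpha> ^ 3 = (1 + p t + q t) ^ 3 * cnj (p t * q t)}"
proof -
  let ?c = "\<lambda>t. (1 + p t + q t) ^ 3 * cnj (p t * q t)"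
  have "?c differentiable_on I"
    using assms unfolding differentiable_on_def power3_eq_cube
    by (simp add: differentiable_cnj_iff)
  then have "negligible (?c ` I)"
    by (intro negligible_differentiable_image_lowdim) auto
  then have "negligible {\<alpha>. \<alpha> ^ 3 \<in> ?c ` I}" by (rule negligible_cube_vimage)
  then show ?thesis by (rule negligible_subset) auto
qed

lemma differentiable_matrix_nth:
  fixes K :: "real \<Rightarrow> complex^'n^'m"
  assumes "K differentiable_on I"
  shows "(\<lambda>t. K t $ i $ j) differentiable_on I"
proof -
  have "bounded_linear (\<lambda>A :: complex^'n^'m. A $ i $ j)"
    using bounded_linear_compose [OF bounded_linear_vec_nth bounded_linear_vec_nth] .
  then have "(\<lambda>A :: complex^'n^'m. A $ i $ j) differentiable_on (K ` I)"
    by (rule bounded_linear_imp_differentiable_on)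
  with assms show ?thesis by (rule differentiable_on_compose)
qed

lemma negligible_X6_family_curve:
  fixes K :: "real \<Rightarrow> complex^6^6"
  assumes "K differentiable_on I"
  shows "negligible {\<alpha>\<in>deltoid_region. \<exists>H\<in>X6_family \<alpha>. \<exists>t\<in>I. hadamard_equivalent H (K t)}"
proof -
  \<comment> \<open>Indexing the Haagerup products by quadruples makes each a differentiable
    function of \<open>t\<close>. A parameter that meets the curve then falls into one of finitely
    many null sets, one for each pair of quadruples.\<close>
  define h where "h = (\<lambda>(i, j, k, l) t. K t $ i $ j * K t $ k $ l * cnj (K t $ i $ l) * cnj (K t $ k $ j))"
  have h: "haagerup_set (K t) = range (\<lambda>x. h x t)" for t
    unfolding haagerup_set_def h_def by (intro image_cong) auto
  have d: "h x differentiable_on I" for x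
    using differentiable_matrix_nth [OF assms]
    unfolding h_def differentiable_on_def
    by (cases x) (simp add: differentiable_cnj_iff)
  have fin: "negligible (\<Union>x. S x)" if "\<And>x. negligible (S x)" for S :: "6 \<times> 6 \<times> 6 \<times> 6 \<Rightarrow> complex set"
  proof (rule negligible_Union)
    show "finite (range S)" by simp
  qed (use that in blast)
  have "negligible (\<Union>x. \<Union>y. {\<alpha>. \<exists>t\<in>I. \<alpha> ^ 3 = (1 + h x t + h y t) ^ 3 * cnj (h x t * h y t)})"
    by (intro fin negligible_cube_curve d)
  then show ?thesis
  proof (rule negligible_subset)
    show "{\<alpha>\<in>deltoid_region. \<exists>H\<in>X6_family \<alpha>. \<exists>t\<in>I. hadamard_equivalent H (K t)}
       \<subseteq> (\<Union>x. \<Union>y. {\<alpha>. \<exists>t\<in>I. \<alpha> ^ 3 = (1 + h x t + h y t) ^ 3 * cnj (h x t * h y t)})"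
    proof
      fix \<alpha> assume "\<alpha> \<in> {\<alpha>\<in>deltoid_region. \<exists>H\<in>X6_family \<alpha>. \<exists>t\<in>I. hadamard_equivalent H (K t)}"
      then obtain H t where "\<alpha> \<in> deltoid_region" "H \<in> X6_family \<alpha>" "t \<in> I" "hadamard_equivalent H (K t)"
        by blast
      have "\<exists>p\<in>haagerup_set (K t). \<exists>q\<in>haagerup_set (K t). \<alpha> ^ 3 = (1 + p + q) ^ 3 * cnj (p * q)"
        by (rule X6_family_equivalent_cube) fact+
      then obtain x y where "\<alpha> ^ 3 = (1 + h x t + h y t) ^ 3 * cnj (h x t * h y t)"
        unfolding h by blast
      with \<open>t \<in> I\<close> show "\<alpha> \<in> (\<Union>x. \<Union>y. {\<alpha>. \<exists>t\<in>I. \<alpha> ^ 3 = (1 + h x t + h y t) ^ 3 * cnj (h x t * h y t)})"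
        by blast
    qed
  qed
qed

lemma negligible_X6_family_fewer:
  assumes "fewer_than_two_parameters \<K>"
  shows "negligible {\<alpha>\<in>deltoid_region. \<exists>H\<in>X6_family \<alpha>. \<exists>K\<in>\<K>. hadamard_equivalent H K}"
proof -
  from assms obtain I :: "nat \<Rightarrow> real set" and K where K: "\<And>n. K n differentiable_on I n" "\<K> = (\<Union>n. K n ` I n)"
    unfolding fewer_than_two_parameters_def by blast
  have "negligible (\<Union>n. {\<alpha>\<in>deltoid_region. \<exists>H\<in>X6_family \<alpha>. \<exists>t\<in>I n. hadamard_equivalent H (K n t)})"
    by (intro negligible_Union_nat negligible_X6_family_curve K)
  then show ?thesis by (rule negligible_subset) (auto simp: K(2))
qed

lemma not_negligible_deltoid_region: "\<not> negligible deltoid_region"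
proof -
  have "\<not> negligible deltoid_interior"
    using open_not_negligible open_deltoid_interior zero_in_deltoid_interior by blast
  moreover have "deltoid_interior \<subseteq> deltoid_region"
    using interior_deltoid_region interior_subset by blast
  ultimately show ?thesis using negligible_subset by blast
qed

text \<open>
  The exponents at the positions \<open>(2,2)\<close> and \<open>(2,3)\<close> are linear functionals on the direction space.
  If they are independent, some member has both entries equal to 1, so that \<open>norm \<alpha> = 3\<close>; if they are
  dependent, all parameters lie in a null set.
\<close>

lemma X6_family_non_affine:
  assumes sub: "\<F> \<subseteq> (\<Union>\<alpha>\<in>deltoid_region. X6_family \<alpha>)"
    and all: "\<And>\<alpha>. \<alpha> \<in> deltoid_region \<Longrightarrow> \<exists>H\<in>X6_family \<alpha>. H \<in> \<F>"
  shows "\<not> affine_family \<F>"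
proof
  assume "affine_family \<F>"
  then obtain H0 \<R> where H0: "complex_hadamard H0" and R: "subspace \<R>"
    and F: "\<F> = {exp_deform H0 R | R. R \<in> \<R>}"
    unfolding affine_family_def by blast
  define a b where "a = (\<lambda>R::real^6^6. R $ 2 $ 2)" and "b = (\<lambda>R::real^6^6. R $ 2 $ 3)"
  \<comment> \<open>With these arguments of the base matrix, the phases of the two entries are
    affine functions of the direction \<open>R\<close>.\<close>
  define \<theta> \<psi> where "\<theta> = Arg (H0 $ 2 $ 2)" and "\<psi> = Arg (H0 $ 2 $ 3)"
  have "H0 $ i $ j = cis (Arg (H0 $ i $ j))" for i j
    using H0 by (simp add: complex_hadamard_def cis_Arg_unimodular del: mem_sphere_0)
  then have h: "exp_deform H0 R $ 2 $ 2 = cis (\<theta> + a R)" "exp_deform H0 R $ 2 $ 3 = cis (\<psi> + b R)" for R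
    unfolding exp_deform_def \<theta>_def \<psi>_def a_def b_def
    by (simp_all add: cis_conv_exp [symmetric] flip: cis_mult)
  show False
  proof (cases "\<exists>R1\<in>\<R>. \<exists>R2\<in>\<R>. a R1 * b R2 - a R2 * b R1 \<noteq> 0")
    case True
    then obtain R1 R2 where r: "R1 \<in> \<R>" "R2 \<in> \<R>" and nz: "a R1 * b R2 - a R2 * b R1 \<noteq> 0"
      by blast
    define d where "d = a R1 * b R2 - a R2 * b R1"
    \<comment> \<open>Cramer's rule for the system \<open>a R' = - \<theta>\<close>,
      \<open>b R' = - \<psi>\<close>, which makes both entries equal to 1.\<close>
    define R' where "R' = ((\<psi> * a R2 - \<theta> * b R2) / d) *\<^sub>R R1 + ((\<theta> * b R1 - \<psi> * a R1) / d) *\<^sub>R R2"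
    have "R' \<in> \<R>" unfolding R'_def using R r by (intro subspace_add subspace_scale)
    then have "exp_deform H0 R' \<in> \<F>" using F by blast
    with sub obtain \<alpha> where \<alpha>: "\<alpha> \<in> deltoid_region" "exp_deform H0 R' \<in> X6_family \<alpha>" by blast
    have "a R' * d = - \<theta> * d" "b R' * d = - \<psi> * d"
      unfolding R'_def a_def b_def using nz
      by (simp_all add: d_def [symmetric] distrib_right, simp_all add: d_def a_def b_def algebra_simps)
    moreover have "d \<noteq> 0" using nz by (simp add: d_def)
    ultimately have "a R' = - \<theta>" "b R' = - \<psi>" by (metis mult_right_cancel)+
    then have "\<theta> + a R' = 0" "\<psi> + b R' = 0" by simp_all
    with X6_family_cube [OF \<alpha>] have "\<alpha> ^ 3 = 3 ^ 3" unfolding h by simp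
    then have "norm \<alpha> ^ 3 = 3 ^ 3" by (metis norm_power norm_numeral)
    then have "norm \<alpha> = 3" by (rule power_eq_imp_eq_base) auto
    \<comment> \<open>For norm 3 the quadratic term of the region inequality alone exceeds
      27.\<close>
    with \<alpha>(1) show False unfolding deltoid_region_abs by simp
  next
    case False
    \<comment> \<open>All determinants vanish, so the pairs \<open>(a R, b R)\<close> lie on one
      line through the origin and the two entries depend on a single real \<open>t\<close>.\<close>
    have "\<exists>a0 b0. \<forall>R\<in>\<R>. \<exists>t. a R = t * a0 \<and> b R = t * b0"
    proof (cases "\<exists>R0\<in>\<R>. a R0 \<noteq> 0 \<or> b R0 \<noteq> 0")
      case True
      then obtain R0 where R0: "R0 \<in> \<R>" "a R0 \<noteq> 0 \<or> b R0 \<noteq> 0" by blast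
      have "\<exists>t. a R = t * a R0 \<and> b R = t * b R0" if "R \<in> \<R>" for R
      proof -
        have e: "a R0 * b R = a R * b R0" using False R0 that by auto
        show ?thesis
        proof (cases "a R0 = 0")
          case True
          with R0 e show ?thesis by (intro exI [of _ "b R / b R0"]) auto
        next
          case False
          with e show ?thesis by (intro exI [of _ "a R / a R0"]) (auto simp: field_simps)
        qed
      qed
      then show ?thesis by blast
    qed auto
    then obtain a0 b0 where ab: "\<And>R. R \<in> \<R> \<Longrightarrow> \<exists>t. a R = t * a0 \<and> b R = t * b0" by blast
    define p q where "p = (\<lambda>t. cis (\<theta> + t * a0))" and "q = (\<lambda>t. cis (\<psi> + t * b0))"
    have "p differentiable_on UNIV" "q differentiable_on UNIV"
      unfolding p_def q_def differentiable_on_def differentiable_def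
      by (auto intro!: exI derivative_eq_intros)
    then have "negligible {\<alpha>. \<exists>t\<in>UNIV. \<alpha> ^ 3 = (1 + p t + q t) ^ 3 * cnj (p t * q t)}"
      by (rule negligible_cube_curve)
    moreover have "deltoid_region \<subseteq> {\<alpha>. \<exists>t\<in>UNIV. \<alpha> ^ 3 = (1 + p t + q t) ^ 3 * cnj (p t * q t)}"
    proof
      fix \<alpha> assume \<alpha>: "\<alpha> \<in> deltoid_region"
      with all F obtain R where "R \<in> \<R>" and H: "exp_deform H0 R \<in> X6_family \<alpha>" by blast
      with ab obtain t where "a R = t * a0" "b R = t * b0" by blast
      with X6_family_cube [OF \<alpha> H]
      have "\<alpha> ^ 3 = (1 + p t + q t) ^ 3 * cnj (p t * q t)" unfolding h p_def q_def by simp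
      then show "\<alpha> \<in> {\<alpha>. \<exists>t\<in>UNIV. \<alpha> ^ 3 = (1 + p t + q t) ^ 3 * cnj (p t * q t)}" by blast
    qed
    ultimately show False using not_negligible_deltoid_region negligible_subset by blast
  qed
qed

section \<open>Local branches\<close>

text \<open>Three distinct points of a circle are not collinear. Conjugating the relation and
  clearing denominators gives a second linear relation, and eliminating either coefficient leaves a
  product of nonzero differences.\<close>

lemma unimodular_chords_independent:
  fixes x y z :: complex
  assumes u: "x \<in> sphere 0 1" "y \<in> sphere 0 1" "z \<in> sphere 0 1"
    and ne: "x \<noteq> y" "x \<noteq> z" "y \<noteq> z"
    and e: "of_real r * (x - z) + of_real s * (y - z) = 0"
  shows "r = 0 \<and> s = 0"
proof -
  have nz: "x \<noteq> 0" "y \<noteq> 0" "z \<noteq> 0" and c: "cnj x = 1 / x" "cnj y = 1 / y" "cnj z = 1 / z"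
    using u unfolding unimodular_iff by auto
  have "of_real r * (1 / x - 1 / z) + of_real s * (1 / y - 1 / z) = 0"
    using arg_cong [OF e, of cnj] by (simp add: c)
  then have e': "of_real r * (x - z) * y + of_real s * (y - z) * x = 0"
    using nz by (simp add: field_simps) algebra
  have "of_real s * ((y - z) * (x - y)) = 0" "of_real r * ((x - z) * (y - x)) = 0"
    using e e' by algebra+
  with ne show ?thesis by simp
qed

text \<open>In terms of the angles of \<open>x\<close> and \<open>y\<close>, the partial derivatives
  of \<open>phi\<close> are \<open>\<i>\<close> times the chords from the third root to
  \<open>x\<close> and to \<open>y\<close>. A nonzero discriminant keeps the three roots distinct,
  so the derivative is injective and the inverse function theorem applies.\<close>

lemma phi_local_branch:
  assumes u: "x0 \<in> sphere 0 1" "y0 \<in> sphere 0 1" and d: "deltoid_fun (phi x0 y0) \<noteq> 0"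
  obtains e X Y where "e > 0"
    "X differentiable_on ball (phi x0 y0) e" "Y differentiable_on ball (phi x0 y0) e"
    "X (phi x0 y0) = x0" "Y (phi x0 y0) = y0"
    "\<And>\<alpha>. \<alpha> \<in> ball (phi x0 y0) e \<Longrightarrow> two_roots \<alpha> (X \<alpha>) (Y \<alpha>)"
proof -
  define f where "f = (\<lambda>w. cis (Re w) + cis (Im w) + cis (- (Re w + Im w)))"
  define A where "A = (\<lambda>w. \<i> * (cis (Re w) - cis (- (Re w + Im w))))"
  define B where "B = (\<lambda>w. \<i> * (cis (Im w) - cis (- (Re w + Im w))))"
  \<comment> \<open>The inverse function theorem asks for the derivative as a continuous map into
    bounded linear operators, so it is assembled from real and imaginary part as
    \<open>Blinfun\<close> objects.\<close>
  define bR bI where "bR = Blinfun (\<lambda>h. complex_of_real (Re h))"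
    and "bI = Blinfun (\<lambda>h. complex_of_real (Im h))"
  have b: "blinfun_apply bR h = of_real (Re h)" "blinfun_apply bI h = of_real (Im h)" for h
    unfolding bR_def bI_def
    by (simp_all add: bounded_linear_Blinfun_apply bounded_linear_compose [OF bounded_linear_of_real]
        bounded_linear_Re bounded_linear_Im)
  define f' where "f' = (\<lambda>w. (blinfun_mult_right (A w) o\<^sub>L bR) + (blinfun_mult_right (B w) o\<^sub>L bI))"
  have f': "blinfun_apply (f' w) h = of_real (Re h) * A w + of_real (Im h) * B w" for w h
    by (simp add: f'_def b blinfun.add_left mult.commute)
  have der: "(f has_derivative blinfun_apply (f' w)) (at w)" for w
    unfolding f_def f' [abs_def] A_def B_def
    by (rule derivative_eq_intros refl)+
      (simp add: fun_eq_iff scaleR_conv_of_real algebra_simps)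
  have cont: "continuous_on UNIV f'"
    unfolding f'_def A_def B_def
    by (intro continuous_intros)
  define w0 where "w0 = Complex (Arg x0) (Arg y0)"
  have inv_cis: "1 / (cis s * cis t) = cis (- (s + t))" for s t
    by (simp add: cis_mult cis_divide flip: cis_zero)
  have fw: "f w = phi (cis (Re w)) (cis (Im w))" for w
    by (simp only: f_def phi_def inv_cis)
  have w0: "cis (Re w0) = x0" "cis (Im w0) = y0" using u by (simp_all add: w0_def cis_Arg_unimodular)
  have f0: "f w0 = phi x0 y0" by (simp add: fw w0)
  have nz: "x0 \<noteq> 0" "y0 \<noteq> 0" using u by auto
  define z0 where "z0 = 1 / (x0 * y0)"
  have z0: "z0 = cis (- (Re w0 + Im w0))" "z0 \<in> sphere 0 1"
    using u by (simp_all only: inv_cis [symmetric] w0 z0_def) (simp add: norm_divide norm_mult)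
  have ne: "x0 \<noteq> y0" "x0 \<noteq> z0" "y0 \<noteq> z0"
    using d deltoid_fun_unimodular [OF u] by (auto simp: z0_def)
  have A0: "A w0 = \<i> * (x0 - z0)" "B w0 = \<i> * (y0 - z0)"
    unfolding A_def B_def z0(1) [symmetric] by (simp_all add: w0)
  have "h = 0" if "blinfun_apply (f' w0) h = 0" for h
  proof -
    have "\<i> * (of_real (Re h) * (x0 - z0) + of_real (Im h) * (y0 - z0)) = 0"
      using that unfolding f' A0 by (simp add: algebra_simps)
    then have "Re h = 0 \<and> Im h = 0"
      by (intro unimodular_chords_independent [OF u z0(2) ne]) simp
    then show ?thesis by (simp add: complex_eq_iff)
  qed
  then have "inj (blinfun_apply (f' w0))"
    by (simp add: linear_injective_0 blinfun.bounded_linear_right bounded_linear.linear)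
  then obtain g0 where g0: "linear g0" "g0 \<circ> blinfun_apply (f' w0) = id"
    using linear_injective_left_inverse blinfun.bounded_linear_right bounded_linear.linear by blast
  have inv: "Blinfun g0 o\<^sub>L f' w0 = id_blinfun"
    using g0 by (intro blinfun_eqI) (simp add: bounded_linear_Blinfun_apply linear_conv_bounded_linear fun_eq_iff)
  obtain U' V g g' where V: "w0 \<in> U'" "open V" "f w0 \<in> V" and hom: "homeomorphism U' V f g"
    and dg: "\<And>y. y \<in> V \<Longrightarrow> (g has_derivative (g' y)) (at y)"
    using inverse_function_theorem [OF open_UNIV der cont UNIV_I inv] by metis
  from V obtain e where e: "e > 0" "ball (phi x0 y0) e \<subseteq> V"
    unfolding f0 using openE by blast
  show ?thesis
  proof (rule that [OF e(1), of "\<lambda>\<alpha>. cis (Re (g \<alpha>))" "\<lambda>\<alpha>. cis (Im (g \<alpha>))"])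
    have "g \<alpha> \<in> UNIV" "f (g \<alpha>) = \<alpha>" if "\<alpha> \<in> ball (phi x0 y0) e" for \<alpha>
      using that e hom by (auto simp: homeomorphism_def)
    then show "two_roots \<alpha> (cis (Re (g \<alpha>))) (cis (Im (g \<alpha>)))" if "\<alpha> \<in> ball (phi x0 y0) e" for \<alpha>
      using that by (subst two_roots_unimodular) (simp_all add: fw)
    have "g (phi x0 y0) = w0" using V hom f0 by (auto simp: homeomorphism_def)
    then show "cis (Re (g (phi x0 y0))) = x0" "cis (Im (g (phi x0 y0))) = y0"
      by (simp_all add: w0)
    show "(\<lambda>\<alpha>. cis (Re (g \<alpha>))) differentiable_on ball (phi x0 y0) e"
      "(\<lambda>\<alpha>. cis (Im (g \<alpha>))) differentiable_on ball (phi x0 y0) e"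
      unfolding differentiable_on_def
    proof safe
      fix \<alpha> assume "\<alpha> \<in> ball (phi x0 y0) e"
      with e dg have "(g has_derivative g' \<alpha>) (at \<alpha> within ball (phi x0 y0) e)"
        by (blast intro: has_derivative_at_withinI)
      note D = has_derivative_Re [OF this] has_derivative_Im [OF this]
      show "(\<lambda>\<alpha>. cis (Re (g \<alpha>))) differentiable at \<alpha> within ball (phi x0 y0) e"
        "(\<lambda>\<alpha>. cis (Im (g \<alpha>))) differentiable at \<alpha> within ball (phi x0 y0) e"
        unfolding differentiable_def
        using has_derivative_cis [OF D(1)] has_derivative_cis [OF D(2)] by blast+
    qed
  qed
qed

text \<open>Differentiability can be tested on coordinates, and the basis vectors of the matrix
  space are supported on a single entry.\<close>

lemma differentiable_on_matrix:
  fixes f :: "'a::real_normed_vector \<Rightarrow> complex^'n^'m"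
  assumes "\<And>i j. (\<lambda>x. f x $ i $ j) differentiable_on S"
  shows "f differentiable_on S"
  unfolding differentiable_on_def
proof
  fix x assume x: "x \<in> S"
  have "\<forall>i j. \<exists>D. ((\<lambda>x. f x $ i $ j) has_derivative D) (at x within S)"
    using assms x by (auto simp: differentiable_on_def differentiable_def)
  then obtain D where D: "\<And>i j. ((\<lambda>x. f x $ i $ j) has_derivative D i j) (at x within S)"
    by metis
  show "f differentiable at x within S"
    unfolding differentiable_def
  proof
    show "(f has_derivative (\<lambda>h. \<chi> i j. D i j h)) (at x within S)"
      unfolding has_derivative_componentwise_within [of f]
    proof
      fix b :: "complex^'n^'m" assume "b \<in> Basis"
      then obtain i j c where b: "b = axis i (axis j c)" unfolding Basis_vec_def by auto
      have "((\<lambda>x. f x $ i $ j \<bullet> c) has_derivative (\<lambda>h. D i j h \<bullet> c)) (at x within S)"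
        by (intro has_derivative_inner_left D)
      then show "((\<lambda>x. f x \<bullet> b) has_derivative (\<lambda>h. (\<chi> i j. D i j h) \<bullet> b)) (at x within S)"
        by (simp add: b inner_axis)
    qed
  qed
qed

text \<open>In the interior both discriminants are nonzero, so \<open>x\<close>, \<open>y\<close>
  continue differentiably near \<open>\<alpha>0\<close> and \<open>u\<close>, \<open>v\<close> near
  \<open>- \<alpha>0\<close>. The second branch is composed with negation.\<close>

lemma X6_family_branch:
  assumes \<alpha>0: "\<alpha>0 \<in> interior deltoid_region" and H: "H \<in> X6_family \<alpha>0"
  shows "\<exists>e>0. \<exists>G. ball \<alpha>0 e \<subseteq> deltoid_region \<and> G differentiable_on ball \<alpha>0 e \<and>
    G \<alpha>0 = H \<and> (\<forall>\<alpha>\<in>ball \<alpha>0 e. G \<alpha> \<in> X6_family \<alpha>)"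
proof -
  from H obtain x y u v where r: "two_roots \<alpha>0 x y" "two_roots (- \<alpha>0) u v" and H: "H = X6 x y u v"
    unfolding X6_family_def by blast
  have "\<alpha>0 \<in> deltoid_region" using \<alpha>0 interior_subset by blast
  then have uni: "x \<in> sphere 0 1" "y \<in> sphere 0 1" "u \<in> sphere 0 1" "v \<in> sphere 0 1"
    using deltoid_region_two_roots r by blast+
  have d: "deltoid_fun \<alpha>0 \<noteq> 0" "deltoid_fun (- \<alpha>0) \<noteq> 0"
    using \<alpha>0 by (auto simp: interior_deltoid_region deltoid_interior_def)
  have p: "phi x y = \<alpha>0" "phi u v = - \<alpha>0" using r by (auto simp: two_roots_iff)
  obtain e1 X Y where 1: "e1 > 0" "X differentiable_on ball \<alpha>0 e1" "Y differentiable_on ball \<alpha>0 e1"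
    "X \<alpha>0 = x" "Y \<alpha>0 = y" "\<And>\<alpha>. \<alpha> \<in> ball \<alpha>0 e1 \<Longrightarrow> two_roots \<alpha> (X \<alpha>) (Y \<alpha>)"
    using phi_local_branch [OF uni(1,2)] d unfolding p by metis
  obtain e2 U V where 2: "e2 > 0" "U differentiable_on ball (- \<alpha>0) e2" "V differentiable_on ball (- \<alpha>0) e2"
    "U (- \<alpha>0) = u" "V (- \<alpha>0) = v" "\<And>\<alpha>. \<alpha> \<in> ball (- \<alpha>0) e2 \<Longrightarrow> two_roots \<alpha> (U \<alpha>) (V \<alpha>)"
    using phi_local_branch [OF uni(3,4)] d unfolding p by metis
  obtain e3 where 3: "e3 > 0" "ball \<alpha>0 e3 \<subseteq> deltoid_region"
    using \<alpha>0 by (auto simp: mem_interior)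
  define e where "e = min e1 (min e2 e3)"
  let ?B = "ball \<alpha>0 e"
  have m: "- \<alpha> \<in> ball (- \<alpha>0) e2" if "\<alpha> \<in> ?B" for \<alpha>
    using that by (auto simp: e_def dist_norm norm_minus_commute)
  have XY: "X differentiable_on ?B" "Y differentiable_on ?B"
    using 1 by (auto intro: differentiable_on_subset simp: e_def subset_ball)
  have UV: "(\<lambda>\<alpha>. U (- \<alpha>)) differentiable_on ?B" "(\<lambda>\<alpha>. V (- \<alpha>)) differentiable_on ?B"
    using 2 m by (auto intro!: differentiable_on_compose [of uminus] differentiable_on_minus
        differentiable_on_ident elim!: differentiable_on_subset)
  define G where "G = (\<lambda>\<alpha>. X6 (X \<alpha>) (Y \<alpha>) (U (- \<alpha>)) (V (- \<alpha>)))"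
  have tr: "two_roots \<alpha> (X \<alpha>) (Y \<alpha>)" "two_roots (- \<alpha>) (U (- \<alpha>)) (V (- \<alpha>))" if "\<alpha> \<in> ?B" for \<alpha>
    using that 1 2 m by (auto simp: e_def)
  have "G differentiable_on ?B"
  proof (rule differentiable_on_matrix)
    fix i j :: 6
    have nz: "X \<alpha> \<noteq> 0" "Y \<alpha> \<noteq> 0" "U (- \<alpha>) \<noteq> 0" "V (- \<alpha>) \<noteq> 0" if "\<alpha> \<in> ?B" for \<alpha>
      using tr [OF that] by (auto simp: two_roots_iff)
    have "\<forall>i j. (\<lambda>\<alpha>. G \<alpha> $ i $ j) differentiable at \<alpha> within ?B" if "\<alpha> \<in> ?B" for \<alpha>
      using XY UV that nz [OF that] unfolding forall_6 G_def X6_nth differentiable_on_def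
      by simp
    then show "(\<lambda>\<alpha>. G \<alpha> $ i $ j) differentiable_on ?B"
      unfolding differentiable_on_def by blast
  qed
  moreover have "e > 0" "?B \<subseteq> deltoid_region" using 1 2 3 by (auto simp: e_def)
  moreover have "G \<alpha>0 = H" using 1 2 by (simp add: G_def H)
  moreover have "\<forall>\<alpha>\<in>?B. G \<alpha> \<in> X6_family \<alpha>"
    using tr unfolding G_def X6_family_def by blast
  ultimately show ?thesis by blast
qed

section \<open>A neighbourhood of 1\<close>

text \<open>Closeness is measured on the fourth power because such errors add up under products of
  unimodular numbers; \<open>n\<close> thus counts factors.\<close>

definition near_fourth_root :: "real \<Rightarrow> real \<Rightarrow> complex \<Rightarrow> bool" where
  "near_fourth_root \<delta> n z \<longleftrightarrow> norm z = 1 \<and> norm (z ^ 4 - 1) \<le> n * \<delta>"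

lemma near_fourth_root_mult:
  assumes "near_fourth_root \<delta> m z" "near_fourth_root \<delta> n w"
  shows "near_fourth_root \<delta> (m + n) (z * w)"
proof -
  have "(z * w) ^ 4 - 1 = z ^ 4 * (w ^ 4 - 1) + (z ^ 4 - 1)" by (simp add: algebra_simps)
  then have "norm ((z * w) ^ 4 - 1) \<le> norm (z ^ 4 * (w ^ 4 - 1)) + norm (z ^ 4 - 1)"
    by (metis norm_triangle_ineq)
  also have "\<dots> = norm (w ^ 4 - 1) + norm (z ^ 4 - 1)"
    using assms by (simp add: near_fourth_root_def norm_mult norm_power)
  also have "\<dots> \<le> (m + n) * \<delta>"
    using assms by (simp add: near_fourth_root_def distrib_right)
  finally show ?thesis
    using assms by (simp add: near_fourth_root_def norm_mult)
qed

lemma near_fourth_root_cnj: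
  assumes "near_fourth_root \<delta> n z"
  shows "near_fourth_root \<delta> n (cnj z)"
proof -
  have "cnj z ^ 4 - 1 = cnj (z ^ 4 - 1)" by simp
  then show ?thesis using assms unfolding near_fourth_root_def by (metis complex_mod_cnj)
qed

lemma near_fourth_root_divide:
  assumes "near_fourth_root \<delta> m z" "near_fourth_root \<delta> n w"
  shows "near_fourth_root \<delta> (m + n) (z / w)"
proof -
  have "w \<in> sphere 0 1" using assms by (simp add: near_fourth_root_def)
  then have "z / w = z * cnj w" unfolding unimodular_iff by simp
  then show ?thesis using assms near_fourth_root_mult near_fourth_root_cnj by simp
qed

lemma near_fourth_root_minus: "near_fourth_root \<delta> n z \<Longrightarrow> near_fourth_root \<delta> n (- z)"
  by (simp add: near_fourth_root_def)

lemma near_fourth_root_one: "near_fourth_root \<delta> 0 1"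
  by (simp add: near_fourth_root_def)

lemma near_fourth_root_mono:
  "near_fourth_root \<delta> m z \<Longrightarrow> m \<le> n \<Longrightarrow> 0 \<le> \<delta> \<Longrightarrow> near_fourth_root \<delta> n z"
  unfolding near_fourth_root_def using mult_right_mono by fastforce

lemmas near_fourth_root_intros =
  near_fourth_root_mult near_fourth_root_divide near_fourth_root_minus near_fourth_root_one

text \<open>Apart from the sign, each entry is a product or quotient of at most four of the roots,
  counted with multiplicity.\<close>

lemma X6_near_fourth_root:
  assumes "near_fourth_root \<delta> 1 x" "near_fourth_root \<delta> 1 y" "near_fourth_root \<delta> 1 u"
    "near_fourth_root \<delta> 1 v" "0 \<le> \<delta>"
  shows "near_fourth_root \<delta> 4 (X6 x y u v $ i $ j)"
proof -
  have "\<forall>i j. near_fourth_root \<delta> 4 (X6 x y u v $ i $ j)"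
    unfolding forall_6 X6_nth power2_eq_square
    by (intro conjI; rule near_fourth_root_mono [OF _ _ assms(5)],
        (rule near_fourth_root_intros assms(1-4))+, simp)
  then show ?thesis by blast
qed

lemma haagerup_set_near_fourth_root:
  assumes "\<And>i j. near_fourth_root \<delta> n (H $ i $ j)" "z \<in> haagerup_set H"
  shows "near_fourth_root \<delta> (n + n + n + n) z"
proof -
  from assms(2) obtain i j k l where "z = H $ i $ j * H $ k $ l * cnj (H $ i $ l) * cnj (H $ k $ j)"
    by (rule haagerup_setE)
  then show ?thesis
    by (simp only: near_fourth_root_mult near_fourth_root_cnj assms(1))
qed

text \<open>The expression is the difference of the cubics at 1 and at \<open>\<alpha>\<close>,
  evaluated at \<open>t\<close>.\<close>

lemma norm_unimodular_quadratic:
  assumes "norm (\<alpha> - 1) \<le> \<epsilon>" "norm t = 1"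
  shows "norm ((\<alpha> - 1) * t\<^sup>2 - (cnj \<alpha> - 1) * t) \<le> 2 * \<epsilon>"
proof -
  have "norm (cnj \<alpha> - 1) = norm (\<alpha> - 1)"
    by (metis complex_cnj_diff complex_cnj_one complex_mod_cnj)
  then have "norm ((\<alpha> - 1) * t\<^sup>2) + norm ((cnj \<alpha> - 1) * t) \<le> 2 * \<epsilon>"
    using assms by (simp add: norm_mult norm_power)
  then show ?thesis using norm_triangle_ineq4 order_trans by blast
qed

text \<open>The cubic for parameter 1 is \<open>(x - 1) * (x\<^sup>2 + 1)\<close>, and multiplying
  by \<open>x + 1\<close> gives \<open>x ^ 4 - 1\<close>. A root for \<open>\<alpha>\<close>
  therefore makes this quantity as small as the perturbation.\<close>

lemma root_near_one:
  assumes "x ^ 3 - \<alpha> * x\<^sup>2 + cnj \<alpha> * x - 1 = 0" "norm x = 1" "norm (\<alpha> - 1) \<le> \<epsilon>"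
  shows "norm (x ^ 4 - 1) \<le> 4 * \<epsilon>"
proof -
  have "x ^ 4 - 1 = (x + 1) * ((\<alpha> - 1) * x\<^sup>2 - (cnj \<alpha> - 1) * x)"
    using assms(1) by algebra
  then have "norm (x ^ 4 - 1) = norm (x + 1) * norm ((\<alpha> - 1) * x\<^sup>2 - (cnj \<alpha> - 1) * x)"
    by (simp add: norm_mult)
  also have "norm (x + 1) \<le> 2"
    using norm_triangle_ineq [of x 1] assms(2) by simp
  then have "norm (x + 1) * norm ((\<alpha> - 1) * x\<^sup>2 - (cnj \<alpha> - 1) * x) \<le> 2 * (2 * \<epsilon>)"
    by (rule mult_mono [OF _ norm_unimodular_quadratic [OF assms(3,2)]]) auto
  finally show ?thesis by simp
qed

text \<open>The cubic for parameter -1 is \<open>(u - 1) * (u + 1)\<^sup>2\<close>; its double root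
  is the source of the square root in the bound. Multiplying by \<open>u - 1\<close> gives the
  square of \<open>u\<^sup>2 - 1\<close>.\<close>

lemma root_near_minus_one:
  assumes "u ^ 3 - (- \<alpha>) * u\<^sup>2 + cnj (- \<alpha>) * u - 1 = 0" "norm u = 1" "norm (\<alpha> - 1) \<le> \<epsilon>"
  shows "norm (u ^ 4 - 1) \<le> 4 * sqrt \<epsilon>"
proof -
  have "(u\<^sup>2 - 1)\<^sup>2 = (1 - u) * ((\<alpha> - 1) * u\<^sup>2 - (cnj \<alpha> - 1) * u)"
    using assms(1) by simp algebra
  then have "(norm (u\<^sup>2 - 1))\<^sup>2 = norm (1 - u) * norm ((\<alpha> - 1) * u\<^sup>2 - (cnj \<alpha> - 1) * u)"
    by (metis norm_mult norm_power)
  also have "norm (1 - u) \<le> 2"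
    using norm_triangle_ineq4 [of 1 u] assms(2) by simp
  then have "norm (1 - u) * norm ((\<alpha> - 1) * u\<^sup>2 - (cnj \<alpha> - 1) * u) \<le> 2 * (2 * \<epsilon>)"
    by (rule mult_mono [OF _ norm_unimodular_quadratic [OF assms(3,2)]]) auto
  finally have "norm (u\<^sup>2 - 1) \<le> sqrt (4 * \<epsilon>)"
    by (intro real_le_rsqrt) simp
  then have *: "norm (u\<^sup>2 - 1) \<le> 2 * sqrt \<epsilon>" by (simp add: real_sqrt_mult)
  have "u ^ 4 - 1 = (u\<^sup>2 + 1) * (u\<^sup>2 - 1)" by algebra
  then have "norm (u ^ 4 - 1) = norm (u\<^sup>2 + 1) * norm (u\<^sup>2 - 1)"
    by (simp add: norm_mult)
  also have "norm (u\<^sup>2 + 1) \<le> 2"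
    using norm_triangle_ineq [of "u\<^sup>2" 1] assms(2) by (simp add: norm_power)
  then have "norm (u\<^sup>2 + 1) * norm (u\<^sup>2 - 1) \<le> 2 * (2 * sqrt \<epsilon>)"
    using * by (rule mult_mono) auto
  finally show ?thesis by simp
qed

text \<open>The third row carries no free phase, so its second entry is a primitive cube root of
  unity for all \<open>a\<close> and \<open>b\<close>.\<close>

lemma cube_root_in_haagerup_set_F6: "cis (2 * pi / 3) \<in> haagerup_set (F6 a b)"
proof -
  have "cis (pi / 3) ^ 2 = cis (2 * pi / 3)" unfolding Complex.DeMoivre by simp
  then have "F6 a b $ 1 $ 1 = 1" "F6 a b $ 1 $ 2 = 1" "F6 a b $ 3 $ 1 = 1"
    "F6 a b $ 3 $ 2 = cis (2 * pi / 3)"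
    by (simp_all add: F6_def Let_def vector_6)
  with haagerup_setI [of "F6 a b" 1 1 3 2] show ?thesis by simp
qed

text \<open>All Haagerup products of \<open>H\<close> are near fourth roots of unity, which the cube
  root is not. Leaving \<open>K\<close> general covers the Fourier matrices and their transposes at
  once.\<close>

lemma X6_family_near_one_not_F6:
  assumes \<alpha>: "\<alpha> \<in> deltoid_region" "norm (\<alpha> - 1) \<le> 1 / 6400" and H: "H \<in> X6_family \<alpha>"
    and K: "cis (2 * pi / 3) \<in> haagerup_set K"
  shows "\<not> hadamard_equivalent H K"
proof
  assume "hadamard_equivalent H K"
  from H obtain x y u v where r: "two_roots \<alpha> x y" "two_roots (- \<alpha>) u v" and X: "H = X6 x y u v"
    unfolding X6_family_def by blast
  have n: "norm x = 1" "norm y = 1" "norm u = 1" "norm v = 1"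
    using deltoid_region_two_roots [OF \<alpha>(1)] r by fastforce+
  \<comment> \<open>The radius makes the error of \<open>u\<close> and \<open>v\<close> at most
    \<open>4 / 80 = 1 / 20\<close>. Haagerup products involve at most 16 roots, so their error is at
    most \<open>16 / 20 = 4 / 5\<close>, below the \<open>3 / 2\<close> found for the cube
    root.\<close>
  have s: "sqrt (1 / 6400) = 1 / 80" by (rule real_sqrt_unique) (simp_all add: power2_eq_square)
  have "near_fourth_root (1 / 20) 1 x" "near_fourth_root (1 / 20) 1 y"
    using root_near_one [OF two_roots_root(1) [OF r(1)] n(1) \<alpha>(2)]
      root_near_one [OF two_roots_root(2) [OF r(1)] n(2) \<alpha>(2)] n
    by (simp_all add: near_fourth_root_def)
  moreover have "near_fourth_root (1 / 20) 1 u" "near_fourth_root (1 / 20) 1 v"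
    using root_near_minus_one [OF two_roots_root(1) [OF r(2)] n(3) \<alpha>(2)]
      root_near_minus_one [OF two_roots_root(2) [OF r(2)] n(4) \<alpha>(2)] n
    unfolding s by (simp_all add: near_fourth_root_def)
  ultimately have "near_fourth_root (1 / 20) 4 (H $ i $ j)" for i j
    unfolding X by (intro X6_near_fourth_root) auto
  moreover have "cis (2 * pi / 3) \<in> haagerup_set H"
    using K haagerup_set_equivalent [OF \<open>hadamard_equivalent H K\<close>] by simp
  ultimately have "near_fourth_root (1 / 20) (4 + 4 + 4 + 4) (cis (2 * pi / 3))"
    by (rule haagerup_set_near_fourth_root)
  then have "norm (cis (2 * pi / 3) ^ 4 - 1) \<le> 4 / 5" by (simp add: near_fourth_root_def)
  moreover have "Re (cis (2 * pi / 3) ^ 4 - 1) = - 3 / 2"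
  proof -
    have "cos (8 * pi / 3) = cos (2 * pi / 3 + 2 * pi)" by (rule arg_cong [of _ _ cos]) simp
    also have "\<dots> = - 1 / 2" unfolding cos_periodic cos_120 ..
    finally show ?thesis
      by (simp add: Complex.DeMoivre)
  qed
  ultimately show False using abs_Re_le_cmod [of "cis (2 * pi / 3) ^ 4 - 1"] by linarith
qed

lemma previously_unknown_X6: "previously_unknown_family deltoid_region X6_family"
proof -
  let ?e = "1 / 6400 :: real"
  have one: "1 \<in> deltoid_region" by (simp add: deltoid_region_abs)
  have near: "norm (\<alpha> - 1) \<le> ?e" if "\<alpha> \<in> ball 1 ?e" for \<alpha> :: complex
    using that by (simp add: dist_norm norm_minus_commute)
  have "\<not> negligible (deltoid_interior \<inter> ball 1 ?e)"
  proof (rule open_not_negligible)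
    \<comment> \<open>The point 1 lies on the boundary, since \<open>deltoid_fun (- 1) = 0\<close>;
      a slightly shrunk point witnesses that the open set is nonempty.\<close>
    have "of_real (1 - ?e / 2) * 1 \<in> deltoid_interior"
      by (rule deltoid_region_shrink [OF one]) auto
    moreover have "(of_real (1 - ?e / 2) * 1 :: complex) \<in> ball 1 ?e"
      by (simp add: dist_norm flip: of_real_diff)
    ultimately show "deltoid_interior \<inter> ball 1 ?e \<noteq> {}" by blast
  qed (simp add: open_deltoid_interior open_Int)
  moreover have "deltoid_interior \<subseteq> deltoid_region"
    using interior_deltoid_region interior_subset by blast
  ultimately have "\<not> negligible (deltoid_region \<inter> ball 1 ?e)"
    by (meson Int_mono negligible_subset order_refl)
  moreover have "\<not> hadamard_equivalent H (F6 a b)" "\<not> hadamard_equivalent H (transpose (F6 a b))"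
    if "\<alpha> \<in> deltoid_region \<inter> ball 1 ?e" "H \<in> X6_family \<alpha>" for \<alpha> H a b
    using that near cube_root_in_haagerup_set_F6 haagerup_set_transpose X6_family_near_one_not_F6
    by (metis Int_iff)+
  moreover have "negligible {\<alpha> \<in> deltoid_region \<inter> ball 1 ?e. \<exists>H\<in>X6_family \<alpha>. \<exists>K\<in>\<K>. hadamard_equivalent H K}"
    if "fewer_than_two_parameters \<K>" for \<K>
    by (rule negligible_subset [OF negligible_X6_family_fewer [OF that]]) auto
  ultimately show ?thesis
    unfolding previously_unknown_family_def using one
    by (intro exI [of _ ?e] conjI ballI allI impI) (simp_all del: mem_ball)
qed

section \<open>The two families\<close>

lemma cnj_in_deltoid_region: "cnj \<alpha> \<in> deltoid_region \<longleftrightarrow> \<alpha> \<in> deltoid_region"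
  unfolding deltoid_region_abs by (simp flip: complex_cnj_power)

lemma cnj_in_deltoid_interior: "cnj \<alpha> \<in> deltoid_interior \<longleftrightarrow> \<alpha> \<in> deltoid_interior"
  unfolding deltoid_interior_abs by (simp flip: complex_cnj_power)

lemma cnj_in_ball: "cnj \<alpha> \<in> ball z e \<longleftrightarrow> \<alpha> \<in> ball (cnj z) e"
proof -
  have "norm (z - cnj \<alpha>) = norm (cnj z - \<alpha>)"
    by (metis complex_cnj_cnj complex_cnj_diff complex_mod_cnj)
  then show ?thesis by (simp add: dist_norm)
qed

lemma X6_family_nonempty: "X6_family \<alpha> \<noteq> {}"
proof -
  obtain x y where "two_roots \<alpha> x y" by (rule two_roots_exist)
  moreover obtain u v where "two_roots (- \<alpha>) u v" by (rule two_roots_exist)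
  ultimately show ?thesis unfolding X6_family_def by blast
qed

lemma X6_family_hadamard:
  assumes "\<alpha> \<in> deltoid_region" "H \<in> X6_family \<alpha>"
  shows "complex_hadamard H"
proof -
  from assms(2) obtain x y u v where r: "two_roots \<alpha> x y" "two_roots (- \<alpha>) u v" and H: "H = X6 x y u v"
    unfolding X6_family_def by blast
  moreover have "phi x y + phi u v = 0" using r by (simp add: two_roots_iff)
  ultimately show ?thesis
    using deltoid_region_two_roots [OF assms(1)] by (auto intro!: X6_hadamard simp del: mem_sphere)
qed

lemma two_parameter_X6: "two_parameter_family deltoid_region X6_family"
  unfolding two_parameter_family_def
proof (intro conjI ballI allI)
  show "interior deltoid_region \<noteq> {}" "deltoid_region \<subseteq> closure (interior deltoid_region)"
    unfolding interior_deltoid_region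
    using zero_in_deltoid_interior deltoid_region_subset_closure by blast+
qed (rule X6_family_nonempty X6_family_branch finite_X6_family_parameters; assumption?)+

text \<open>Everything is transported along \<open>cnj\<close>, which is differentiable over the
  reals, preserves the region and its interior, and is a bijection.\<close>

lemma two_parameter_X6T: "two_parameter_family deltoid_region X6T_family"
  unfolding two_parameter_family_def
proof (intro conjI ballI allI)
  show "interior deltoid_region \<noteq> {}" "deltoid_region \<subseteq> closure (interior deltoid_region)"
    unfolding interior_deltoid_region
    using zero_in_deltoid_interior deltoid_region_subset_closure by blast+
  show "X6T_family \<alpha> \<noteq> {}" for \<alpha> unfolding X6T_family_eq by (rule X6_family_nonempty)
next
  fix \<alpha>0 H assume "\<alpha>0 \<in> interior deltoid_region" "H \<in> X6T_family \<alpha>0"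
  then have "cnj \<alpha>0 \<in> interior deltoid_region" "H \<in> X6_family (cnj \<alpha>0)"
    by (simp_all add: interior_deltoid_region cnj_in_deltoid_interior X6T_family_eq)
  from X6_family_branch [OF this] obtain e G where e: "e > 0" "ball (cnj \<alpha>0) e \<subseteq> deltoid_region"
    and G: "G differentiable_on ball (cnj \<alpha>0) e" "G (cnj \<alpha>0) = H"
      "\<forall>\<alpha>\<in>ball (cnj \<alpha>0) e. G \<alpha> \<in> X6_family \<alpha>"
    by blast
  have b: "cnj \<alpha> \<in> ball (cnj \<alpha>0) e \<longleftrightarrow> \<alpha> \<in> ball \<alpha>0 e" for \<alpha>
    by (simp only: cnj_in_ball complex_cnj_cnj)
  have "(\<lambda>\<alpha>. G (cnj \<alpha>)) differentiable_on ball \<alpha>0 e"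
  proof (rule differentiable_on_compose [where g = cnj and f = G])
    show "cnj differentiable_on ball \<alpha>0 e"
      by (intro bounded_linear_imp_differentiable_on bounded_linear_cnj)
    show "G differentiable_on cnj ` ball \<alpha>0 e"
      using b by (intro differentiable_on_subset [OF G(1)]) blast
  qed
  moreover have "ball \<alpha>0 e \<subseteq> deltoid_region" using e(2) b cnj_in_deltoid_region by blast
  moreover have "\<forall>\<alpha>\<in>ball \<alpha>0 e. G (cnj \<alpha>) \<in> X6T_family \<alpha>" using G(3) b X6T_family_eq by blast
  ultimately show "\<exists>e>0. \<exists>G. ball \<alpha>0 e \<subseteq> deltoid_region \<and> G differentiable_on ball \<alpha>0 e \<and>
      G \<alpha>0 = H \<and> (\<forall>\<alpha>\<in>ball \<alpha>0 e. G \<alpha> \<in> X6T_family \<alpha>)"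
    using e(1) G(2) by (intro exI [of _ e] conjI exI [of _ "\<lambda>\<alpha>. G (cnj \<alpha>)"])
next
  fix K
  have "{\<alpha>\<in>deltoid_region. \<exists>H\<in>X6T_family \<alpha>. hadamard_equivalent H K} \<subseteq>
      cnj ` {\<alpha>\<in>deltoid_region. \<exists>H\<in>X6_family \<alpha>. hadamard_equivalent H K}"
  proof
    fix \<alpha> assume "\<alpha> \<in> {\<alpha>\<in>deltoid_region. \<exists>H\<in>X6T_family \<alpha>. hadamard_equivalent H K}"
    then show "\<alpha> \<in> cnj ` {\<alpha>\<in>deltoid_region. \<exists>H\<in>X6_family \<alpha>. hadamard_equivalent H K}"
      by (intro image_eqI [of _ _ "cnj \<alpha>"]) (simp_all add: cnj_in_deltoid_region X6T_family_eq)
  qed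
  then show "finite {\<alpha>\<in>deltoid_region. \<exists>H\<in>X6T_family \<alpha>. hadamard_equivalent H K}"
    by (rule finite_subset [OF _ finite_imageI [OF finite_X6_family_parameters]])
qed

lemma non_affine_X6: "non_affine_family deltoid_region X6_family"
  unfolding non_affine_family_def
proof (intro conjI allI impI)
  show "\<not> affine_family (\<Union>\<alpha>\<in>deltoid_region. X6_family \<alpha>)"
    using X6_family_nonempty by (intro X6_family_non_affine) blast+
  show "\<not> affine_family (G ` deltoid_region)" if "\<forall>\<alpha>\<in>deltoid_region. G \<alpha> \<in> X6_family \<alpha>" for G
    using that by (intro X6_family_non_affine) blast+
qed

lemma non_affine_X6T: "non_affine_family deltoid_region X6T_family"
  unfolding non_affine_family_def X6T_family_eq
proof (intro conjI allI impI)
  \<comment> \<open>Since the region is closed under conjugation, every parameter is the conjugate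
    of another one; so the union is unchanged, and a choice of members for the transposed family
    still meets \<open>X6_family\<close> at every parameter.\<close>
  have *: "X6_family \<alpha> = X6_family (cnj (cnj \<alpha>))" for \<alpha> by simp
  have "(\<Union>\<alpha>\<in>deltoid_region. X6_family (cnj \<alpha>)) = (\<Union>\<alpha>\<in>deltoid_region. X6_family \<alpha>)"
    using cnj_in_deltoid_region * by blast
  then show "\<not> affine_family (\<Union>\<alpha>\<in>deltoid_region. X6_family (cnj \<alpha>))"
    using non_affine_X6 unfolding non_affine_family_def by simp
  show "\<not> affine_family (G ` deltoid_region)"
    if G: "\<forall>\<alpha>\<in>deltoid_region. G \<alpha> \<in> X6_family (cnj \<alpha>)" for G
  proof (rule X6_family_non_affine)
    show "G ` deltoid_region \<subseteq> (\<Union>\<alpha>\<in>deltoid_region. X6_family \<alpha>)"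
      using G cnj_in_deltoid_region by blast
    show "\<exists>H\<in>X6_family \<alpha>. H \<in> G ` deltoid_region" if "\<alpha> \<in> deltoid_region" for \<alpha>
      using G that * cnj_in_deltoid_region by blast
  qed
qed

text \<open>Conjugation fixes 1, preserves balls around it and pulls null sets back to null sets, so
  the same radius works.\<close>

lemma previously_unknown_X6T: "previously_unknown_family deltoid_region X6T_family"
proof -
  obtain e where e: "e > 0" "1 \<in> deltoid_region" "\<not> negligible (deltoid_region \<inter> ball 1 e)"
    and F: "\<And>\<alpha> H a b. \<alpha> \<in> deltoid_region \<inter> ball 1 e \<Longrightarrow> H \<in> X6_family \<alpha> \<Longrightarrow>
      \<not> hadamard_equivalent H (F6 a b) \<and> \<not> hadamard_equivalent H (transpose (F6 a b))"
    and N: "\<And>\<K>. fewer_than_two_parameters \<K> \<Longrightarrow>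
      negligible {\<alpha> \<in> deltoid_region \<inter> ball 1 e. \<exists>H\<in>X6_family \<alpha>. \<exists>K\<in>\<K>. hadamard_equivalent H K}"
    using previously_unknown_X6 unfolding previously_unknown_family_def by blast
  have D: "cnj \<alpha> \<in> deltoid_region \<inter> ball 1 e \<longleftrightarrow> \<alpha> \<in> deltoid_region \<inter> ball 1 e" for \<alpha>
    by (simp only: Int_iff cnj_in_deltoid_region cnj_in_ball complex_cnj_one)
  have "negligible {\<alpha> \<in> deltoid_region \<inter> ball 1 e. \<exists>H\<in>X6_family (cnj \<alpha>). \<exists>K\<in>\<K>. hadamard_equivalent H K}"
    if K: "fewer_than_two_parameters \<K>" for \<K>
  proof -
    let ?T = "{\<alpha> \<in> deltoid_region \<inter> ball 1 e. \<exists>H\<in>X6_family \<alpha>. \<exists>K\<in>\<K>. hadamard_equivalent H K}"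
    have "negligible {\<alpha> \<in> UNIV. cnj \<alpha> \<in> ?T}"
    proof (rule negligible_differentiable_vimage [OF N [OF K]])
      show "(cnj has_derivative cnj) (at \<alpha> within UNIV)" for \<alpha>
        by (intro bounded_linear_imp_has_derivative bounded_linear_cnj)
    qed (simp add: inj_def)
    then show ?thesis by (rule negligible_subset) (use D in blast)
  qed
  then show ?thesis
    unfolding previously_unknown_family_def X6T_family_eq
    using e F D by (intro exI [of _ e] conjI ballI allI impI) blast+
qed

theorem theorem2p2:
  shows "(\<forall>F \<in> {X6_family, X6T_family}.
            (\<forall>\<alpha>\<in>deltoid_region. \<forall>H\<in>F \<alpha>. complex_hadamard H) \<and>
            two_parameter_family deltoid_region F \<and>
            non_affine_family deltoid_region F \<and>
            previously_unknown_family deltoid_region F) \<and>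
         (\<exists>\<alpha>\<in>deltoid_region. X6_family \<alpha> \<noteq> X6T_family \<alpha>)"
proof
  have "complex_hadamard H" if "\<alpha> \<in> deltoid_region" "H \<in> X6T_family \<alpha>" for \<alpha> H
    using that X6_family_hadamard [of "cnj \<alpha>"] by (simp add: X6T_family_eq cnj_in_deltoid_region)
  then show "\<forall>F \<in> {X6_family, X6T_family}.
            (\<forall>\<alpha>\<in>deltoid_region. \<forall>H\<in>F \<alpha>. complex_hadamard H) \<and>
            two_parameter_family deltoid_region F \<and>
            non_affine_family deltoid_region F \<and>
            previously_unknown_family deltoid_region F"
    using X6_family_hadamard two_parameter_X6 two_parameter_X6T non_affine_X6 non_affine_X6T
      previously_unknown_X6 previously_unknown_X6T by blast
next
  \<comment> \<open>A small parameter with a non-real cube: a matrix shared by both families here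
    would force \<open>\<alpha> ^ 3\<close> to be real, because its entries determine the cube of
    the parameter.\<close>
  define \<alpha> where "\<alpha> = \<i> / 10"
  have cube: "\<alpha> ^ 3 = - \<i> / 1000" by (simp add: \<alpha>_def power_divide power3_eq_cube)
  have norm: "norm \<alpha> = 1 / 10" by (simp add: \<alpha>_def norm_divide)
  have \<alpha>: "\<alpha> \<in> deltoid_region" unfolding deltoid_region_abs cube norm by (simp add: power_divide)
  obtain H where H: "H \<in> X6_family \<alpha>" using X6_family_nonempty by blast
  have "X6_family \<alpha> \<noteq> X6T_family \<alpha>"
  proof
    assume "X6_family \<alpha> = X6T_family \<alpha>"
    with H have "H \<in> X6_family (cnj \<alpha>)" by (simp add: X6T_family_eq)
    with \<alpha> H have "\<alpha> ^ 3 = cnj \<alpha> ^ 3"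
      by (metis X6_family_cube cnj_in_deltoid_region)
    then have "\<alpha> ^ 3 = cnj (\<alpha> ^ 3)" by simp
    then show False unfolding cube by (simp add: complex_eq_iff)
  qed
  with \<alpha> show "\<exists>\<alpha>\<in>deltoid_region. X6_family \<alpha> \<noteq> X6T_family \<alpha>" by blast
qed

end
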